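(* Let $\Bbbk$ be an algebraically closed field of characteristic $p>2$. Let $\epsilon\in\{1,-1\}$, $q_{12},q_{21},q_{22}\in\Bbbk^\times$ and $a\in\Bbbk$, and let $V$ be the braided vector space with basis $x_1,x_2,x_3$ and braiding $$c(x_i\otimes x_1)=\epsilon x_1\otimes x_i,\quad c(x_i\otimes x_2)=(\epsilon x_2+x_1)\otimes x_i,\quad c(x_i\otimes x_3)=q_{12}x_3\otimes x_i\quad (i=1,2),$$ $$c(x_3\otimes x_1)=q_{21}x_1\otimes x_3,\quad c(x_3\otimes x_2)=q_{21}(x_2+a x_1)\otimes x_3,\quad c(x_3\otimes x_3)=q_{22}x_3\otimes x_3.$$ Suppose that one of the following holds: (1) $\epsilon=1$, $q_{12}q_{21}=1$, $q_{22}=1$, $a\in\mathbb{F}_p^\times$; (2) $\epsilon=1$, $q_{12}q_{21}=1$, $q_{22}=-1$, $a\in\mathbb{F}_p^\times$; (3) $\epsilon=1$, $q_{12}q_{21}=1$, $q_{22}$ is a primitive cube root of unity, and $2a=-1$; (4) $\epsilon=-1$, $q_{12}q_{21}=1$, $q_{22}=1$, $a\in\mathbb{F}_p^\times$; (5) $\epsilon=-1$, $q_{12}q_{21}=1$, $q_{22}=-1$, $a\in\mathbb{F}_p^\times$; (6) $\epsilon=-1$, $q_{12}q_{21}=-1$, $q_{22}=-1$, $a=1$. Then the Nichols algebra $\mathfrak{B}(V)$ is finite-dimensional.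
   Context: $\mathbb{F}_p\subseteq\Bbbk$ is the prime field. For a braided vector space $(V,c)$, the Nichols algebra $\mathfrak{B}(V)$ is $T(V)/\mathcal{J}(V)$, where $\mathcal{J}(V)$ is the largest homogeneous Hopf ideal of the braided Hopf algebra $T(V)$ contained in $\bigoplus_{n\ge2}T^n(V)$. (In case (3), the value of the paper's normalized "ghost" is $1$, i.e. $2a\equiv -1 \pmod p$.) *)

theory Defs
  imports "HOL-Computational_Algebra.Polynomial"
begin

datatype idx = X1 | X2 | X3

lemma UNIV_idx: "(UNIV :: idx set) = {X1, X2, X3}"
  using idx.exhaust by auto

instance idx :: finite
  by standard (simp add: UNIV_idx)

(* Elements of T(V) are coefficient functions on words (idx list); a word w of
   length n stands for the basis tensor x_{w!0} \<otimes> ... \<otimes> x_{w!(n-1)} of T^n(V).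
   Elements of T(V) \<otimes> T(V) are coefficient functions on pairs of words.

   A braiding of the shape  c(x_i \<otimes> x_j) = g_i(x_j) \<otimes> x_i  (which is the shape of
   the braiding in the statement) is encoded by
     act i j k = coefficient of x_k in g_i(x_j). *)

type_synonym 'k brd = "idx \<Rightarrow> idx \<Rightarrow> idx \<Rightarrow> 'k"

definition hom :: "nat \<Rightarrow> (idx list \<Rightarrow> 'k::zero) \<Rightarrow> bool" where
  "hom n u \<longleftrightarrow> (\<forall>w. length w \<noteq> n \<longrightarrow> u w = 0)"

definition in_span :: "('a \<Rightarrow> 'k::field) set \<Rightarrow> ('a \<Rightarrow> 'k) \<Rightarrow> bool" where
  "in_span S f \<longleftrightarrow> (\<exists>F c. finite F \<and> F \<subseteq> S \<and> f = (\<lambda>p. \<Sum>g\<in>F. c g * g p))"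

definition tmult :: "(idx list \<Rightarrow> 'k::field) \<Rightarrow> (idx list \<Rightarrow> 'k) \<Rightarrow> idx list \<Rightarrow> 'k" where
  "tmult u t v = (\<Sum>k\<le>length v. u (take k v) * t (drop k v))"

definition tens :: "(idx list \<Rightarrow> 'k::field) \<Rightarrow> (idx list \<Rightarrow> 'k) \<Rightarrow> idx list \<times> idx list \<Rightarrow> 'k" where
  "tens a t = (\<lambda>(v1, v2). a v1 * t v2)"

(* gw act b x y = coefficient of x_y in g_{b_1} (g_{b_2} (... g_{b_m} (x_x))) ;
   c(x_{b_1}...x_{b_m} \<otimes> x) = g_{b_1}...g_{b_m}(x) \<otimes> x_{b_1}...x_{b_m} *)
primrec gw :: "'k::field brd \<Rightarrow> idx list \<Rightarrow> idx \<Rightarrow> idx \<Rightarrow> 'k" where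
  "gw act [] x y = (if x = y then 1 else 0)"
| "gw act (i # b) x y = (\<Sum>z\<in>UNIV. gw act b x z * act i z y)"

(* Coproduct of T(V) as a braided bialgebra: the algebra map T(V) \<rightarrow> T(V) \<otimes> T(V)
   (braided tensor product algebra) with \<Delta>(x) = x \<otimes> 1 + 1 \<otimes> x, computed via
   \<Delta>(x w) = (x \<otimes> 1 + 1 \<otimes> x) \<Delta>(w), where
   (1 \<otimes> x)(a \<otimes> b) = c(x \<otimes> a) b = g_x^{\<otimes> |a|}(a) \<otimes> x b.
   Delta act w (a,b) = coefficient of a \<otimes> b in \<Delta>(w). *)
primrec Delta :: "'k::field brd \<Rightarrow> idx list \<Rightarrow> idx list \<times> idx list \<Rightarrow> 'k" where
  "Delta act [] p = (if p = ([], []) then 1 else 0)"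
| "Delta act (x # w) p =
     (if fst p \<noteq> [] \<and> hd (fst p) = x then Delta act w (tl (fst p), snd p) else 0)
   + (if snd p \<noteq> [] \<and> hd (snd p) = x then
        (\<Sum>a'\<in>{a'. length a' = length (fst p)}.
            Delta act w (a', tl (snd p)) * (\<Prod>i<length (fst p). act x (a' ! i) (fst p ! i)))
      else 0)"

definition Delta_lin :: "'k::field brd \<Rightarrow> (idx list \<Rightarrow> 'k) \<Rightarrow> idx list \<times> idx list \<Rightarrow> 'k" where
  "Delta_lin act u p = (\<Sum>w\<in>{w. length w = length (fst p) + length (snd p)}. u w * Delta act w p)"

(* Antipode of T(V): S(x)=-x, S(uv) = m (S\<otimes>S) c(u \<otimes> v); hence
   S(w x) = - g_w(x) S(w).  Srev act r = S(rev r). *)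
primrec Srev :: "'k::field brd \<Rightarrow> idx list \<Rightarrow> idx list \<Rightarrow> 'k" where
  "Srev act [] v = (if v = [] then 1 else 0)"
| "Srev act (x # r) v =
     (if v = [] then 0 else - gw act (rev r) x (hd v) * Srev act r (tl v))"

definition S_lin :: "'k::field brd \<Rightarrow> (idx list \<Rightarrow> 'k) \<Rightarrow> idx list \<Rightarrow> 'k" where
  "S_lin act u v = (\<Sum>w\<in>{w. length w = length v}. u w * Srev act (rev w) v)"

definition hopf_ideal_fam :: "'k::field brd \<Rightarrow> (nat \<Rightarrow> (idx list \<Rightarrow> 'k) set) \<Rightarrow> bool" where
  "hopf_ideal_fam act I \<longleftrightarrow>
     (\<forall>n. (\<lambda>_. 0) \<in> I n \<and> (\<forall>u\<in>I n. hom n u)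
          \<and> (\<forall>u\<in>I n. \<forall>v\<in>I n. (\<lambda>w. u w + v w) \<in> I n)
          \<and> (\<forall>u\<in>I n. \<forall>c. (\<lambda>w. c * u w) \<in> I n))
   \<and> (\<forall>n u. n < 2 \<and> u \<in> I n \<longrightarrow> u = (\<lambda>_. 0))
   \<and> (\<forall>n m u t. u \<in> I n \<and> hom m t \<longrightarrow> tmult t u \<in> I (m + n) \<and> tmult u t \<in> I (n + m))
   \<and> (\<forall>n u. u \<in> I n \<longrightarrow> u [] = 0)
   \<and> (\<forall>n u. u \<in> I n \<longrightarrow>
          in_span ({tens a t | a t k m. a \<in> I k \<and> hom m t} \<union> {tens t a | a t k m. a \<in> I k \<and> hom m t})
                  (Delta_lin act u))
   \<and> (\<forall>n u. u \<in> I n \<longrightarrow> S_lin act u \<in> I n)"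

(* degree-n component of J(V), the largest homogeneous Hopf ideal in \<oplus>_{n\<ge>2} T^n(V)
   (the sum of all such ideals) *)
definition nichols_J :: "'k::field brd \<Rightarrow> nat \<Rightarrow> (idx list \<Rightarrow> 'k) set" where
  "nichols_J act n = {u. in_span (\<Union>{I n | I. hopf_ideal_fam act I}) u}"

(* B(V) = \<oplus>_n T^n(V)/J^n(V), each T^n finite-dimensional; so B(V) is finite-dimensional
   iff J^n = T^n for all large n *)
definition nichols_fin_dim :: "'k::field brd \<Rightarrow> bool" where
  "nichols_fin_dim act \<longleftrightarrow> (\<exists>N. \<forall>n\<ge>N. \<forall>u. hom n u \<longrightarrow> u \<in> nichols_J act n)"

fun braid_V :: "'k::field \<Rightarrow> 'k \<Rightarrow> 'k \<Rightarrow> 'k \<Rightarrow> 'k \<Rightarrow> 'k brd" where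
  "braid_V eps q12 q21 q22 a X3 X1 k = (if k = X1 then q21 else 0)"
| "braid_V eps q12 q21 q22 a X3 X2 k = (if k = X2 then q21 else if k = X1 then q21 * a else 0)"
| "braid_V eps q12 q21 q22 a X3 X3 k = (if k = X3 then q22 else 0)"
| "braid_V eps q12 q21 q22 a i X1 k = (if k = X1 then eps else 0)"
| "braid_V eps q12 q21 q22 a i X2 k = (if k = X2 then eps else if k = X1 then 1 else 0)"
| "braid_V eps q12 q21 q22 a i X3 k = (if k = X3 then q12 else 0)"

definition alg_closed :: "'k::field itself \<Rightarrow> bool" where
  "alg_closed _ \<longleftrightarrow> (\<forall>P :: 'k poly. degree P > 0 \<longrightarrow> (\<exists>x. poly P x = 0))"

definition in_Fp_units :: "'k::field \<Rightarrow> bool" where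
  "in_Fp_units a \<longleftrightarrow> a \<noteq> 0 \<and> (\<exists>m::nat. a = of_nat m)"

end

theory Submission
  imports Defs
begin

text \<open>The Nichols algebra of a braiding of group type is the image of the tensor algebra in the
  quantum shuffle algebra, on which removing the first letter acts by skew derivations. Left
  multiplications, skew derivations and the braiding generate a ring of linear operators, in which an
  operator without constant term that commutes with all skew derivations up to right factors vanishes;
  all relations below are checked by this criterion.

  Words in the generators are then moved into PBW form \<open>z\<^sub>i\<dots>z\<^sub>j x\<^sub>k\<dots>x\<^sub>l\<close>, where \<open>x\<^sub>k, x\<^sub>l\<close> belong to the block and
  the \<open>z\<^sub>i\<close> are iterated braided commutators of \<open>x\<^sub>2\<close> (and \<open>x\<^sub>1\<close>) with \<open>x\<^sub>3\<close>. In characteristic \<open>p\<close> the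
  block is nilpotent, only finitely many \<open>z\<^sub>i\<close> are nonzero, and the \<open>z\<^sub>i\<close> commute up to scalars and
  lower terms and are nilpotent; hence long words vanish.\<close>

section \<open>The ring of linear operators on a space of functions\<close>

text \<open>\<open>nichols_J\<close> is the sum of all Hopf ideals, so one Hopf ideal that fills
  every large degree already bounds the Nichols algebra; the kernel of the quantum symmetrizer
  serves. Operators replace elements because multiplication by a letter, removal of a letter and the
  group action then live in one associative ring: a skew Leibniz rule becomes a commutation rule,
  and checking a relation becomes term rewriting. The obstacle in bounding word length is that
  moving a letter past a generator can create a new generator and so shorten the word; hence
  generators carry weights, and it is the weight that never drops. The family \<open>zs\<close>
  stops because its derivative under \<open>d3\<close> is \<open>xi n * h\<close>, where
  \<open>xi n\<close> is a multiple of \<open>x1 ^ n\<close> for the Jordan block, and of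
  \<open>y ^ k\<close> or \<open>x1 * y ^ k\<close> for the super Jordan block, and
  \<open>x1\<close> resp. \<open>y\<close> has vanishing \<open>p\<close>-th power. For
  \<open>2 * a = - 1\<close> the coefficient of \<open>xi n\<close> is already zero at
  \<open>n = 2\<close>. For \<open>sg = - 1\<close> this description does not apply, and four
  explicit generators are used.\<close>

typedef (overloaded) ('a, 'k::field) lop =
  "{T :: ('a \<Rightarrow> 'k) \<Rightarrow> 'a \<Rightarrow> 'k. \<forall>c u v. T (\<lambda>w. u w + c * v w) = (\<lambda>w. T u w + c * T v w)}"
  morphisms app Lop
  by (rule exI[of _ "\<lambda>u. u"]) simp

setup_lifting type_definition_lop

lemma app_lin: "app R (\<lambda>w. u w + c * v w) = (\<lambda>w. app R u w + c * app R v w)"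
  using app[of R] by simp

lemma app_add: "app R (\<lambda>w. u w + v w) = (\<lambda>w. app R u w + app R v w)"
  using app_lin[of R u 1 v] by simp

lemma app_zero [simp]: "app R (\<lambda>w. 0) = (\<lambda>w. 0)"
  using app_lin[of R "\<lambda>w. 0" "-1" "\<lambda>w. 0"] by simp

lemma app_scale: "app R (\<lambda>w. c * v w) = (\<lambda>w. c * app R v w)"
  using app_lin[of R "\<lambda>w. 0" c v] by simp

lemma lop_eqI: "(\<And>f w. app R f w = app S f w) \<Longrightarrow> R = S"
  by (metis app_inject ext)

instantiation lop :: (type, field) ring_1
begin

lift_definition zero_lop :: "('a, 'b) lop" is "\<lambda>f w. 0" by simp
lift_definition one_lop :: "('a, 'b) lop" is "\<lambda>f. f" by simp
lift_definition plus_lop :: "('a, 'b) lop \<Rightarrow> ('a, 'b) lop \<Rightarrow> ('a, 'b) lop" is "\<lambda>R S f w. R f w + S f w"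
  by (simp add: algebra_simps)
lift_definition minus_lop :: "('a, 'b) lop \<Rightarrow> ('a, 'b) lop \<Rightarrow> ('a, 'b) lop" is "\<lambda>R S f w. R f w - S f w"
  by (simp add: algebra_simps)
lift_definition uminus_lop :: "('a, 'b) lop \<Rightarrow> ('a, 'b) lop" is "\<lambda>R f w. - R f w"
  by (simp add: algebra_simps)
lift_definition times_lop :: "('a, 'b) lop \<Rightarrow> ('a, 'b) lop \<Rightarrow> ('a, 'b) lop" is "\<lambda>R S f. R (S f)"
  by simp

instance
proof
  fix a b c :: "('a, 'b) lop"
  show "a * (b + c) = a * b + a * c"
    by (rule lop_eqI) (simp add: plus_lop.rep_eq times_lop.rep_eq app_add)
  show "(0::('a, 'b) lop) \<noteq> 1"
  proof
    assume "(0::('a, 'b) lop) = 1"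
    then have "app (0::('a, 'b) lop) (\<lambda>_. 1) undefined = app 1 (\<lambda>_. 1) undefined" by simp
    then show False by (simp add: zero_lop.rep_eq one_lop.rep_eq)
  qed
qed (transfer; simp add: algebra_simps; fail)+

end

lemmas app_ring = zero_lop.rep_eq one_lop.rep_eq plus_lop.rep_eq minus_lop.rep_eq
  uminus_lop.rep_eq times_lop.rep_eq

lift_definition smul :: "'k::field \<Rightarrow> ('a, 'k) lop \<Rightarrow> ('a, 'k) lop" (infixr "\<bullet>" 75)
  is "\<lambda>c R f w. c * R f w"
  by (simp add: algebra_simps)

global_interpretation lop: vector_space "smul :: 'k::field \<Rightarrow> ('a, 'k) lop \<Rightarrow> ('a, 'k) lop"
  by standard (transfer; simp add: algebra_simps)+

lemma smul_mult [simp]: "(c \<bullet> R) * S = c \<bullet> (R * S)"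
  by transfer simp

lemma mult_smul [simp]: "R * (c \<bullet> S) = c \<bullet> (R * S)"
  by (rule lop_eqI) (simp add: times_lop.rep_eq smul.rep_eq app_scale)

declare lop.scale_one [simp]

lemma lop_smul_uminus: "(- 1) \<bullet> R = - R"
  by simp

lemma of_nat_smul: "of_nat n \<bullet> R = of_nat n * R"
  by (induction n) (simp_all add: algebra_simps)

lemma lop_char: "of_nat CHAR('k) * (R :: ('a, 'k::field) lop) = 0"
  by (simp add: of_nat_smul[symmetric])

section \<open>Nilpotent sets of operators\<close>

definition nilp :: "'o::ring_1 set \<Rightarrow> bool" where
  "nilp S \<longleftrightarrow> (\<exists>n. \<forall>xs. set xs \<subseteq> S \<and> n \<le> length xs \<longrightarrow> prod_list xs = 0)"

lemma nilp_singleton: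
  assumes "z ^ n = 0" shows "nilp {z}"
proof -
  have "prod_list xs = z ^ length xs" if "set xs \<subseteq> {z}" for xs
    using that by (induction xs) auto
  then show ?thesis unfolding nilp_def using assms
    by (metis le_add_diff_inverse mult_zero_left power_add)
qed

lemma nilp_subset: "nilp T \<Longrightarrow> S \<subseteq> T \<Longrightarrow> nilp S"
  unfolding nilp_def by (meson order_trans)

lemma nilp_empty: "nilp {}"
  unfolding nilp_def by (rule exI[of _ 1]) (auto simp: Suc_le_eq)

text \<open>The second component of a pair is a weight, typically the degree of the generator: in
  \<open>x2 * z = z' + z * x2\<close> the single factor \<open>z'\<close> then counts as much as two
  factors. At most one letter remains on the right, so that an exchange leaves at most one letter to
  be pushed further.\<close>

definition pbw_terms :: "('a, 'k::field) lop set \<Rightarrow> (('a, 'k) lop \<times> nat) set \<Rightarrow> nat \<Rightarrow> ('a, 'k) lop set" where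
  "pbw_terms X Z n = {prod_list (map fst zs) * prod_list ls | zs ls.
     set zs \<subseteq> Z \<and> set ls \<subseteq> X \<and> length ls \<le> 1 \<and> n \<le> sum_list (map snd zs) + length ls}"

lemma pbw_z: "(z, w) \<in> Z \<Longrightarrow> n \<le> w \<Longrightarrow> z \<in> pbw_terms X Z n"
  unfolding pbw_terms_def by (intro CollectI exI[of _ "[(z, w)]"] exI[of _ "[]"]) simp

lemma pbw_zx: "(z, w) \<in> Z \<Longrightarrow> x \<in> X \<Longrightarrow> n \<le> Suc w \<Longrightarrow> z * x \<in> pbw_terms X Z n"
  unfolding pbw_terms_def by (intro CollectI exI[of _ "[(z, w)]"] exI[of _ "[x]"]) simp

lemma pbw_zz: "(z, w) \<in> Z \<Longrightarrow> (z', w') \<in> Z \<Longrightarrow> n \<le> w + w' \<Longrightarrow> z * z' \<in> pbw_terms X Z n"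
  unfolding pbw_terms_def by (intro CollectI exI[of _ "[(z, w), (z', w')]"] exI[of _ "[]"]) simp

lemmas pbw_span = lop.span_zero lop.span_add lop.span_diff lop.span_neg lop.span_scale

text \<open>Letters can be moved to the right of the generators without lowering the weight,
  so a long word is a combination of monomials having many generators or many letters.\<close>

lemma nilp_pbw:
  fixes X :: "('a, 'k::field) lop set" and Z :: "(('a, 'k) lop \<times> nat) set"
  assumes nX: "nilp X" and nZ: "nilp (fst ` Z)"
    and wt: "\<And>z w. (z, w) \<in> Z \<Longrightarrow> 1 \<le> w \<and> w \<le> P"
    and ex: "\<And>x z w. x \<in> X \<Longrightarrow> (z, w) \<in> Z \<Longrightarrow> x * z \<in> lop.span (pbw_terms X Z (Suc w))"
  shows "nilp (X \<union> fst ` Z)"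
proof -
  define W where "W zs = sum_list (map snd zs)" for zs :: "(('a, 'k) lop \<times> nat) list"
  define p where "p zs = prod_list (map fst zs)" for zs :: "(('a, 'k) lop \<times> nat) list"
  \<comment> \<open>Ordered monomials filtered by weight, each letter counting 1.\<close>
  define M where "M d = {p zs * prod_list xs | zs xs. set zs \<subseteq> Z \<and> set xs \<subseteq> X \<and> d \<le> W zs + length xs}" for d
  have MI: "p zs * prod_list xs \<in> lop.span (M d)"
    if "set zs \<subseteq> Z" "set xs \<subseteq> X" "d \<le> W zs + length xs" for zs xs d
    using that unfolding M_def by (intro lop.span_base) blast
  have span_mult: "R * s \<in> lop.span B" if "s \<in> lop.span A" "\<And>a. a \<in> A \<Longrightarrow> R * a \<in> lop.span B" for R s A B
    using that(1)
    by (induction rule: lop.span_induct_alt)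
      (auto simp: distrib_left intro: lop.span_add lop.span_scale lop.span_zero that(2))
  have span_mult': "s * R \<in> lop.span B" if "s \<in> lop.span A" "\<And>a. a \<in> A \<Longrightarrow> a * R \<in> lop.span B" for R s A B
    using that(1)
    by (induction rule: lop.span_induct_alt)
      (auto simp: distrib_right intro: lop.span_add lop.span_scale lop.span_zero that(2))
  have zM: "p ks * s \<in> lop.span (M (W ks + d))" if "s \<in> lop.span (M d)" "set ks \<subseteq> Z" for ks s d
  proof (rule span_mult[OF that(1)])
    fix a assume "a \<in> M d"
    then obtain zs xs where "a = p zs * prod_list xs" "set zs \<subseteq> Z" "set xs \<subseteq> X" "d \<le> W zs + length xs"
      unfolding M_def by blast
    then show "p ks * a \<in> lop.span (M (W ks + d))"
      using MI[of "ks @ zs" xs] that(2) by (simp add: p_def W_def mult.assoc)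
  qed
  have mono: "lop.span (M d) \<subseteq> lop.span (M e)" if "e \<le> d" for d e
    using that unfolding M_def by (intro lop.span_mono) (blast intro: order_trans)
  \<comment> \<open>Induction along the generators: an exchange with the first one leaves at most
    one letter \<open>l\<close>, which is then pushed through the shorter list
    \<open>zs\<close>.\<close>
  have push: "x * p zs * prod_list xs \<in> lop.span (M (Suc (W zs + length xs)))"
    if "set zs \<subseteq> Z" "set xs \<subseteq> X" "x \<in> X" for x zs xs
    using that
  proof (induction zs arbitrary: x)
    case Nil
    then show ?case using MI[of "[]" "x # xs"] by (simp add: p_def W_def)
  next
    case (Cons zw zs)
    obtain z w where zw: "zw = (z, w)" by force
    have xz: "x * z \<in> lop.span (pbw_terms X Z (Suc w))" using ex Cons.prems zw by auto
    have "x * z * (p zs * prod_list xs) \<in> lop.span (M (Suc (w + W zs + length xs)))"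
    proof (rule span_mult'[OF xz])
      fix s assume "s \<in> pbw_terms X Z (Suc w)"
      then obtain ks ls where s: "s = p ks * prod_list ls" "set ks \<subseteq> Z" "set ls \<subseteq> X" "length ls \<le> 1"
          "Suc w \<le> W ks + length ls"
        unfolding pbw_terms_def p_def W_def by blast
      show "s * (p zs * prod_list xs) \<in> lop.span (M (Suc (w + W zs + length xs)))"
      proof (cases ls)
        case Nil
        then show ?thesis using MI[of "ks @ zs" xs] s Cons.prems
          by (simp add: p_def W_def mult.assoc)
      next
        case (Cons l ls')
        then have ls: "ls = [l]" using s(4) by simp
        have "l * p zs * prod_list xs \<in> lop.span (M (Suc (W zs + length xs)))"
          using Cons.IH[of l] Cons.prems s(3) ls by simp
        from zM[OF this s(2)]
        have "p ks * (l * p zs * prod_list xs) \<in> lop.span (M (Suc (w + W zs + length xs)))"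
          using mono[of "Suc (w + W zs + length xs)" "W ks + Suc (W zs + length xs)"] s(5) ls by auto
        then show ?thesis by (simp add: s(1) ls mult.assoc)
      qed
    qed
    then show ?case by (simp add: zw p_def W_def mult.assoc)
  qed
  have word: "prod_list ys \<in> lop.span (M (length ys))" if "set ys \<subseteq> X \<union> fst ` Z" for ys
    using that
  proof (induction ys)
    case Nil
    then show ?case using MI[of "[]" "[]" 0] by (simp add: p_def W_def)
  next
    case (Cons y ys)
    then have IH: "prod_list ys \<in> lop.span (M (length ys))" by simp
    consider "y \<in> X" | w where "(y, w) \<in> Z" using Cons.prems by auto
    then show ?case
    proof cases
      case 1
      have "y * prod_list ys \<in> lop.span (M (Suc (length ys)))"
      proof (rule span_mult[OF IH])
        fix a assume "a \<in> M (length ys)"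
        then obtain zs xs where "a = p zs * prod_list xs" "set zs \<subseteq> Z" "set xs \<subseteq> X" "length ys \<le> W zs + length xs"
          unfolding M_def by blast
        then show "y * a \<in> lop.span (M (Suc (length ys)))"
          using push[of zs xs y] 1 mono[of "Suc (length ys)" "Suc (W zs + length xs)"]
          by (auto simp: mult.assoc)
      qed
      then show ?thesis by simp
    next
      case 2
      then have "y * prod_list ys \<in> lop.span (M (w + length ys))"
        using zM[OF IH, of "[(y, w)]"] by (simp add: p_def W_def)
      then show ?thesis using mono[of "Suc (length ys)" "w + length ys"] wt[OF 2] by auto
    qed
  qed
  obtain n1 where n1: "\<And>xs. set xs \<subseteq> X \<Longrightarrow> n1 \<le> length xs \<Longrightarrow> prod_list xs = 0"
    using nX unfolding nilp_def by blast
  obtain m where m: "\<And>xs. set xs \<subseteq> fst ` Z \<Longrightarrow> m \<le> length xs \<Longrightarrow> prod_list xs = 0"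
    using nZ unfolding nilp_def by blast
  have W: "W zs \<le> P * length zs" if "set zs \<subseteq> Z" for zs
    using that
  proof (induction zs)
    case (Cons zw zs)
    then show ?case using wt[of "fst zw" "snd zw"] by (auto simp: W_def)
  qed (simp add: W_def)
  \<comment> \<open>Fewer than \<open>m\<close> generators account for a weight of at most
    \<open>P * m\<close>, so at least \<open>n1\<close> letters are left over.\<close>
  have "prod_list ys = 0" if "set ys \<subseteq> X \<union> fst ` Z" "P * m + n1 \<le> length ys" for ys
  proof -
    have "M (length ys) \<subseteq> {0}"
    proof
      fix a assume "a \<in> M (length ys)"
      then obtain zs xs where a: "a = p zs * prod_list xs" "set zs \<subseteq> Z" "set xs \<subseteq> X"
          "length ys \<le> W zs + length xs"
        unfolding M_def by blast
      show "a \<in> {0}"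
      proof (cases "m \<le> length zs")
        case True
        then have "p zs = 0" using m[of "map fst zs"] a(2) by (simp add: p_def image_mono)
        then show ?thesis using a by simp
      next
        case False
        then have "P * length zs \<le> P * m" by simp
        then have "n1 \<le> length xs" using W[OF a(2)] a(4) that(2) by linarith
        then show ?thesis using n1[of xs] a by simp
      qed
    qed
    then have "lop.span (M (length ys)) \<subseteq> lop.span {0}" by (rule lop.span_mono)
    then show ?thesis using word[OF that(1)] by auto
  qed
  then show ?thesis unfolding nilp_def by blast
qed

text \<open>The elements are adjoined one at a time; a swap never shortens a product, so weight 1
  suffices.\<close>

lemma nilp_skew_commuting:
  fixes z :: "nat \<Rightarrow> ('a, 'k::field) lop"
  assumes "\<And>i. i < n \<Longrightarrow> nilp {z i}"
    and "\<And>i j. i < n \<Longrightarrow> j < n \<Longrightarrow> \<exists>c. z i * z j = c \<bullet> (z j * z i)"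
  shows "nilp (z ` {..<n})"
  using assms
proof (induction n)
  case 0
  then show ?case by (simp add: nilp_empty)
next
  case (Suc n)
  have "nilp (z ` {..<n} \<union> fst ` {(z n, 1::nat)})"
  proof (rule nilp_pbw[where P = 1])
    show "nilp (z ` {..<n})" using Suc by simp
    show "nilp (fst ` {(z n, 1::nat)})" using Suc.prems(1)[of n] by simp
    fix x y w assume x: "x \<in> z ` {..<n}" and y: "(y, w) \<in> {(z n, 1::nat)}"
    then obtain c where c: "x * y = c \<bullet> (y * x)" using Suc.prems(2)[of _ n] by force
    show "x * y \<in> lop.span (pbw_terms (z ` {..<n}) {(z n, 1::nat)} (Suc w))"
      unfolding c using x y by (intro lop.span_scale lop.span_base pbw_zx) auto
  qed auto
  then show ?case by (simp add: lessThan_Suc)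
qed

section \<open>The quantum shuffle algebra\<close>

text \<open>The coefficient at the given word of the diagonal action of g_i on the tensor
  \<open>f\<close>. Tensors are coefficient functions, so the output letter \<open>j\<close> is
  fixed and the input letter \<open>k\<close> is summed over.\<close>

primrec gact :: "'k::field brd \<Rightarrow> idx \<Rightarrow> idx list \<Rightarrow> (idx list \<Rightarrow> 'k) \<Rightarrow> 'k" where
  "gact act i [] f = f []"
| "gact act i (j # w) f = (\<Sum>k\<in>UNIV. act i k j * gact act i w (\<lambda>v. f (k # v)))"

text \<open>The product for which the removal of the first letter \<open>j\<close> is a skew derivation
  twisted by \<open>g\<^sub>j\<close> in the second factor.\<close>

primrec shuf :: "'k::field brd \<Rightarrow> idx list \<Rightarrow> (idx list \<Rightarrow> 'k) \<Rightarrow> (idx list \<Rightarrow> 'k) \<Rightarrow> 'k" where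
  "shuf act [] F f = F [] * f []"
| "shuf act (j # w) F f =
     shuf act w F (\<lambda>v. f (j # v)) + shuf act w (\<lambda>v. F (j # v)) (\<lambda>v. gact act j v f)"

definition flin :: "(('a \<Rightarrow> 'k::field) \<Rightarrow> 'k) \<Rightarrow> bool" where
  "flin T \<longleftrightarrow> (\<forall>c u v. T (\<lambda>w. u w + c * v w) = T u + c * T v)"

lemma flin_add: "flin T \<Longrightarrow> T (\<lambda>w. u w + v w) = T u + T v"
  unfolding flin_def by (metis (no_types, lifting) mult_1 ext)

lemma flin_zero:
  assumes "flin T" shows "T (\<lambda>w. 0) = 0"
proof -
  have "T (\<lambda>w. 0 + (- 1) * 0) = T (\<lambda>w. 0) + (- 1) * T (\<lambda>w. 0)"
    using assms[unfolded flin_def, rule_format, of "\<lambda>w. 0" "- 1" "\<lambda>w. 0"] .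
  then show ?thesis by simp
qed

lemma flin_scale: "flin T \<Longrightarrow> T (\<lambda>w. c * v w) = c * T v"
  using flin_zero[of T] unfolding flin_def by (metis (no_types, lifting) add_0 ext)

lemma flin_sum:
  assumes "flin T" shows "T (\<lambda>w. \<Sum>t\<in>A. c t * f t w) = (\<Sum>t\<in>A. c t * T (f t))"
proof (induction A rule: infinite_finite_induct)
  case (insert x A)
  then show ?case
    using flin_add[OF assms, of "\<lambda>w. c x * f x w" "\<lambda>w. \<Sum>t\<in>A. c t * f t w"]
    by (simp add: flin_scale[OF assms])
qed (simp_all add: flin_zero assms)

lemma flin_gact: "flin (gact act i w)"
  unfolding flin_def
  by (induction w) (simp_all add: algebra_simps sum.distrib sum_distrib_left)

lemma flin_shuf1: "flin (\<lambda>F. shuf act w F f)"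
  unfolding flin_def
  by (induction w arbitrary: f) (simp_all add: algebra_simps)

lemma flin_shuf2: "flin (shuf act w F)"
proof -
  have "shuf act w F (\<lambda>w. u w + c * v w) = shuf act w F u + c * shuf act w F v" for c u v
  proof (induction w arbitrary: F u v)
    case (Cons j w)
    have "(\<lambda>w. gact act j w (\<lambda>w. u w + c * v w)) = (\<lambda>w. gact act j w u + c * gact act j w v)"
      using flin_gact unfolding flin_def by blast
    with Cons show ?case by (simp add: algebra_simps)
  qed (simp add: algebra_simps)
  then show ?thesis unfolding flin_def by blast
qed

abbreviation Ls :: "nat \<Rightarrow> idx list set" where
  "Ls n \<equiv> {w. length w = n}"

lemma finite_Ls [simp]: "finite (Ls n)"
  using finite_lists_length_eq[OF finite_UNIV[where 'a = idx], of n] by simp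

lemma sum_Ls_Suc: "(\<Sum>v\<in>Ls (Suc n). f v) = (\<Sum>i\<in>UNIV. \<Sum>v\<in>Ls n. f (i # v))"
  unfolding sum.cartesian_product
  by (rule sum.reindex_bij_witness[of _ "\<lambda>(i, v). i # v" "\<lambda>v. (hd v, tl v)"]) (auto simp: length_Suc_conv)

lemma sum_Ls_Suc_snoc: "(\<Sum>v\<in>Ls (Suc n). f v) = (\<Sum>v\<in>Ls n. \<Sum>i\<in>UNIV. f (v @ [i]))"
  unfolding sum.cartesian_product
  by (rule sum.reindex_bij_witness[of _ "\<lambda>(v, i). v @ [i]" "\<lambda>v. (butlast v, last v)"])
    (auto simp: append_butlast_last_id length_greater_0_conv[symmetric] simp del: length_greater_0_conv)

definition sh1 :: "idx list \<Rightarrow> 'k::field" where "sh1 w = (if w = [] then 1 else 0)"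
definition she :: "idx \<Rightarrow> idx list \<Rightarrow> 'k::field" where "she i w = (if w = [i] then 1 else 0)"

lemma sh1_simps [simp]: "sh1 [] = 1" "sh1 (j # w) = 0"
  by (auto simp: sh1_def)

lemma she_simps [simp]: "she i [] = 0" "she i (j # w) = (if i = j then sh1 w else 0)"
  by (auto simp: she_def sh1_def)

lemma gact_sh1 [simp]: "gact act i w sh1 = sh1 w"
  by (cases w) (simp_all add: flin_zero[OF flin_gact])

lemma shuf_0_left [simp]: "shuf act w (\<lambda>v. 0) f = 0"
  by (rule flin_zero[OF flin_shuf1])

lemma shuf_0_right [simp]: "shuf act w F (\<lambda>v. 0) = 0"
  by (rule flin_zero[OF flin_shuf2])

lemma shuf_sh1_left [simp]: "shuf act w sh1 f = f w"
  by (induction w arbitrary: f) simp_all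

lemma shuf_sh1_right [simp]: "shuf act w F sh1 = F w"
  by (induction w arbitrary: F) simp_all

lemma shuf_she_Cons [simp]:
  "shuf act (j # w) (she i) f = shuf act w (she i) (\<lambda>v. f (j # v)) + (if i = j then gact act i w f else 0)"
  by simp

lemma hom_gact: "hom n f \<Longrightarrow> length w \<noteq> n \<Longrightarrow> gact act i w f = 0"
proof (induction w arbitrary: n f)
  case (Cons j w)
  show ?case
  proof (cases n)
    case 0
    then have "(\<lambda>v. f (k # v)) = (\<lambda>v. 0)" for k using Cons.prems(1) by (auto simp: hom_def)
    then show ?thesis by (simp add: flin_zero[OF flin_gact])
  next
    case (Suc m)
    then have "hom m (\<lambda>v. f (k # v))" for k using Cons.prems(1) by (auto simp: hom_def)
    then show ?thesis using Cons.IH[of m] Cons.prems(2) Suc by simp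
  qed
qed (simp add: hom_def)

lemma hom_shuf: "hom n F \<Longrightarrow> hom m f \<Longrightarrow> length w \<noteq> n + m \<Longrightarrow> shuf act w F f = 0"
proof (induction w arbitrary: n m F f)
  case (Cons j w)
  have "shuf act w F (\<lambda>v. f (j # v)) = 0"
  proof (cases m)
    case 0
    then have "(\<lambda>v. f (j # v)) = (\<lambda>v. 0)" using Cons.prems(2) by (auto simp: hom_def)
    then show ?thesis by simp
  next
    case (Suc m')
    then have "hom m' (\<lambda>v. f (j # v))" using Cons.prems(2) by (auto simp: hom_def)
    then show ?thesis using Cons.IH[of n F m'] Cons.prems Suc by simp
  qed
  moreover have "shuf act w (\<lambda>v. F (j # v)) (\<lambda>v. gact act j v f) = 0"
  proof (cases n)
    case 0
    then have "(\<lambda>v. F (j # v)) = (\<lambda>v. 0)" using Cons.prems(1) by (auto simp: hom_def)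
    then show ?thesis by simp
  next
    case (Suc n')
    then have "hom n' (\<lambda>v. F (j # v))" using Cons.prems(1) by (auto simp: hom_def)
    moreover have "hom m (\<lambda>v. gact act j v f)" using Cons.prems(2) hom_gact unfolding hom_def by blast
    ultimately show ?thesis using Cons.IH[of n'] Cons.prems Suc by simp
  qed
  ultimately show ?case by simp
qed (auto simp: hom_def)

text \<open>The image of a word under the algebra map from T(V) to the quantum shuffle algebra that
  fixes the letters; as a matrix indexed by two words it is the quantum symmetrizer.\<close>

primrec phi :: "'k::field brd \<Rightarrow> idx list \<Rightarrow> idx list \<Rightarrow> 'k" where
  "phi act [] = sh1"
| "phi act (i # w) = (\<lambda>v. shuf act v (she i) (phi act w))"

lemma hom_phi: "hom (length w) (phi act w)"
proof (induction w)
  case (Cons i w)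
  have "hom 1 (she i)" by (auto simp: hom_def she_def)
  from hom_shuf[OF this Cons] show ?case by (auto simp: hom_def)
qed (simp add: hom_def sh1_def)

lemma phi_0: "length v \<noteq> length w \<Longrightarrow> phi act w v = 0"
  using hom_phi[of w act] by (simp add: hom_def)

text \<open>Apart from invertibility, the conditions of a Yetter-Drinfeld module over an abelian
  group: the g_i commute, and each of them mixes only letters that have the same group
  element.\<close>

locale group_braiding =
  fixes act :: "'k::field brd"
  assumes act_comm: "(\<Sum>k\<in>UNIV. act j l k * act i k m) = (\<Sum>k\<in>UNIV. act i l k * act j k m)"
    and act_same: "act i j m \<noteq> 0 \<Longrightarrow> act m = act j"
begin

section \<open>Associativity of the quantum shuffle product\<close>

lemma gact_commute: "gact act i w (\<lambda>v. gact act l v f) = gact act l w (\<lambda>v. gact act i v f)"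
proof (induction w arbitrary: f)
  case (Cons j w)
  define D where "D i l m = gact act i w (\<lambda>v. gact act l v (\<lambda>v. f (m # v)))" for i l m
  have *: "gact act i (j # w) (\<lambda>v. gact act l v f) =
      (\<Sum>m\<in>UNIV. (\<Sum>k\<in>UNIV. act l m k * act i k j) * D i l m)" for i l
  proof -
    have "gact act i (j # w) (\<lambda>v. gact act l v f) = (\<Sum>k\<in>UNIV. act i k j * (\<Sum>m\<in>UNIV. act l m k * D i l m))"
      by (simp add: flin_sum[OF flin_gact] D_def)
    also have "\<dots> = (\<Sum>m\<in>UNIV. \<Sum>k\<in>UNIV. act i k j * (act l m k * D i l m))"
      by (subst sum.swap) (simp add: sum_distrib_left)
    finally show ?thesis by (simp add: sum_distrib_left sum_distrib_right mult_ac)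
  qed
  have "D i l m = D l i m" for m unfolding D_def by (rule Cons)
  then show ?case using act_comm[of l _ i j] by (simp only: *)
qed simp

lemma gact_same: "act m = act j \<Longrightarrow> gact act m w f = gact act j w f"
  by (induction w arbitrary: f) simp_all

text \<open>Removing the first letter twists by g_k on one side and by g_j on the other; wherever
  \<open>act i k j\<close> is nonzero these agree by \<open>act_same\<close>, and commutativity of
  the g's does the rest.\<close>

lemma gact_shuf: "gact act i w (\<lambda>v. shuf act v F f) = shuf act w (\<lambda>v. gact act i v F) (\<lambda>v. gact act i v f)"
proof (induction w arbitrary: F f)
  case (Cons j w)
  let ?g = "\<lambda>f v. gact act i v f"
  have *: "act i k j * shuf act w (?g (\<lambda>v. F (k # v))) (?g (\<lambda>v. gact act k v f))
     = act i k j * shuf act w (?g (\<lambda>v. F (k # v))) (\<lambda>v. gact act j v (?g f))" for k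
  proof (cases "act i k j = 0")
    case False
    have "?g (\<lambda>v. gact act k v f) = (\<lambda>v. gact act j v (?g f))"
      by (simp add: gact_commute[of i _ k] gact_same[OF act_same[OF False]])
    then show ?thesis by simp
  qed simp
  have "gact act i (j # w) (\<lambda>v. shuf act v F f) =
     (\<Sum>k\<in>UNIV. act i k j * shuf act w (?g F) (?g (\<lambda>v. f (k # v))))
     + (\<Sum>k\<in>UNIV. act i k j * shuf act w (?g (\<lambda>v. F (k # v))) (?g (\<lambda>v. gact act k v f)))"
    by (simp add: flin_add[OF flin_gact] Cons algebra_simps sum.distrib)
  then show ?case
    by (simp add: * flin_sum[OF flin_shuf1] flin_sum[OF flin_shuf2])
qed simp

lemma shuf_assoc: "shuf act w (\<lambda>v. shuf act v A B) C = shuf act w A (\<lambda>v. shuf act v B C)"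
proof (induction w arbitrary: A B C)
  case (Cons j w)
  then show ?case
    by (simp add: flin_add[OF flin_shuf1] flin_add[OF flin_shuf2] gact_shuf)
qed simp

lemma phi_append: "phi act (a @ b) = (\<lambda>v. shuf act v (phi act a) (phi act b))"
  by (induction a) (simp_all add: shuf_assoc)

definition gc :: "idx \<Rightarrow> idx list \<Rightarrow> idx list \<Rightarrow> 'k" where
  "gc y s t = (\<Prod>i<length t. act y (s ! i) (t ! i))"

lemma gc_Nil [simp]: "gc y [] [] = 1" by (simp add: gc_def)

lemma gc_Cons [simp]: "gc y (s # ss) (t # ts) = act y s t * gc y ss ts"
  by (simp only: gc_def length_Cons prod.lessThan_Suc_shift) simp

lemma gc_snoc: "length ss = length ts \<Longrightarrow> gc y (ss @ [s]) (ts @ [t]) = gc y ss ts * act y s t"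
  unfolding gc_def by (simp add: nth_append)

lemma gact_she: "gact act y w (she s) = (\<Sum>t\<in>UNIV. act y s t * she t w)"
proof (cases w)
  case (Cons j w')
  have "act y k j * gact act y w' (\<lambda>v. she s (k # v)) = (if s = k then act y s j * sh1 w' else 0)" for k
    by (cases "s = k") (simp_all add: flin_zero[OF flin_gact])
  moreover have "act y s t * she t (j # w') = (if j = t then act y s j * sh1 w' else 0)" for t
    by (cases "j = t") simp_all
  ultimately show ?thesis by (simp add: Cons del: she_simps)
qed simp

lemma gact_phi: "gact act y w (phi act a) = (\<Sum>a'\<in>Ls (length a). gc y a a' * phi act a' w)"
proof (induction a arbitrary: w)
  case (Cons s a)
  have "gact act y w (phi act (s # a)) =
     (\<Sum>t\<in>UNIV. act y s t * (\<Sum>a'\<in>Ls (length a). gc y a a' * shuf act w (she t) (phi act a')))"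
    by (simp add: gact_shuf Cons gact_she flin_sum[OF flin_shuf1] flin_sum[OF flin_shuf2])
  also have "\<dots> = (\<Sum>a'\<in>Ls (Suc (length a)). gc y (s # a) a' * phi act a' w)"
    by (simp add: sum_Ls_Suc sum_distrib_left mult_ac)
  finally show ?case by simp
qed simp

lemma gact_append:
  "gact act i (w1 @ w2) f = gact act i w1 (\<lambda>u. gact act i w2 (\<lambda>v. f (u @ v)))"
  by (induction w1 arbitrary: f) simp_all

text \<open>The new letter lands either in \<open>w2\<close> or in \<open>w1\<close>; in the second
  case g_i acts on everything to its right, hence on all of \<open>w2\<close>.\<close>

lemma shuf_she_append:
  "shuf act (w1 @ w2) (she i) f = shuf act w2 (she i) (\<lambda>v. f (w1 @ v))
     + shuf act w1 (she i) (\<lambda>u. gact act i w2 (\<lambda>v. f (u @ v)))"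
proof (induction w1 arbitrary: f)
  case (Cons j w1)
  then show ?case by (simp add: gact_append del: shuf.simps(2))
qed simp

end

section \<open>The kernel of the quantum symmetrizer is a Hopf ideal\<close>

lemma in_span_base: "g \<in> S \<Longrightarrow> in_span S g"
  unfolding in_span_def by (intro exI[of _ "{g}"] exI[of _ "\<lambda>_. 1"]) auto

lemma in_span_zero: "in_span S (\<lambda>p. 0)"
  unfolding in_span_def by (intro exI[of _ "{}"]) auto

lemma in_span_add:
  assumes "in_span S f" "in_span S g" shows "in_span S (\<lambda>p. f p + g p)"
proof -
  obtain F c G d where F: "finite F" "F \<subseteq> S" "f = (\<lambda>p. \<Sum>g\<in>F. c g * g p)"
    and G: "finite G" "G \<subseteq> S" "g = (\<lambda>p. \<Sum>g\<in>G. d g * g p)"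
    using assms unfolding in_span_def by blast
  define e where "e h = (if h \<in> F then c h else 0) + (if h \<in> G then d h else 0)" for h
  have "f p + g p = (\<Sum>h\<in>F \<union> G. e h * h p)" for p
  proof -
    have "(\<Sum>h\<in>F \<union> G. e h * h p) = (\<Sum>h\<in>F \<union> G. if h \<in> F then c h * h p else 0)
        + (\<Sum>h\<in>F \<union> G. if h \<in> G then d h * h p else 0)"
      unfolding sum.distrib[symmetric] by (intro sum.cong) (auto simp: e_def algebra_simps)
    then show ?thesis
      using F(1) G(1) by (simp add: F(3) G(3) sum.inter_restrict[symmetric] Int_absorb1 Int_absorb2)
  qed
  then show ?thesis
    unfolding in_span_def using F G by (intro exI[of _ "F \<union> G"] exI[of _ e]) auto
qed

lemma in_span_sum:
  assumes "\<And>t. t \<in> A \<Longrightarrow> in_span S (f t)" shows "in_span S (\<lambda>p. \<Sum>t\<in>A. f t p)"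
  using assms
  by (induction A rule: infinite_finite_induct) (simp_all add: in_span_zero in_span_add)

text \<open>Extracts a basis together with the matrix \<open>P\<close> of coordinates. The basis is
  a set of indices, because different words can have the same image under
  \<open>phi\<close>.\<close>

lemma independent_subfamily:
  fixes f :: "'i \<Rightarrow> 'a \<Rightarrow> 'k::field"
  assumes "finite S"
  shows "\<exists>B P. B \<subseteq> S \<and> (\<forall>b\<in>S. \<forall>v. f b v = (\<Sum>b'\<in>B. P b b' * f b' v))
    \<and> (\<forall>c. (\<forall>v. (\<Sum>b\<in>B. c b * f b v) = 0) \<longrightarrow> (\<forall>b\<in>B. c b = 0))"
  using assms
proof induction
  case (insert x S)
  then obtain B P where BP: "B \<subseteq> S \<and> (\<forall>b\<in>S. \<forall>v. f b v = (\<Sum>b'\<in>B. P b b' * f b' v))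
      \<and> (\<forall>c. (\<forall>v. (\<Sum>b\<in>B. c b * f b v) = 0) \<longrightarrow> (\<forall>b\<in>B. c b = 0))"
    by blast
  have B: "B \<subseteq> S" "\<And>b v. b \<in> S \<Longrightarrow> f b v = (\<Sum>b'\<in>B. P b b' * f b' v)"
    and ind: "\<And>c b. (\<And>v. (\<Sum>b\<in>B. c b * f b v) = 0) \<Longrightarrow> b \<in> B \<Longrightarrow> c b = 0"
    using BP by auto
  have fin: "finite B" "x \<notin> B" using B(1) insert.hyps finite_subset by auto
  show ?case
  proof (cases "\<exists>d. \<forall>v. f x v = (\<Sum>b'\<in>B. d b' * f b' v)")
    case True
    then obtain d where "\<And>v. f x v = (\<Sum>b'\<in>B. d b' * f b' v)" by blast
    then show ?thesis using B ind by (intro exI[of _ B] exI[of _ "P(x := d)"]) auto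
  next
    case False
    define Q where "Q b b' = (if b = x then (if b' = x then 1 else 0) else if b' = x then 0 else P b b')" for b b'
    have "f b v = (\<Sum>b'\<in>insert x B. Q b b' * f b' v)" if "b \<in> insert x S" for b v
    proof (cases "b = x")
      case True
      have "(\<Sum>b'\<in>B. Q b b' * f b' v) = 0"
        using fin True by (intro sum.neutral) (auto simp: Q_def)
      then show ?thesis using fin True by (simp add: Q_def)
    next
      case False
      have "(\<Sum>b'\<in>B. Q b b' * f b' v) = (\<Sum>b'\<in>B. P b b' * f b' v)"
        using fin False by (intro sum.cong) (auto simp: Q_def)
      then show ?thesis using fin False B(2)[of b v] that by (simp add: Q_def)
    qed
    moreover have "\<forall>b\<in>insert x B. c b = 0" if c: "\<forall>v. (\<Sum>b\<in>insert x B. c b * f b v) = 0" for c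
    proof -
      have eq: "c x * f x v + (\<Sum>b\<in>B. c b * f b v) = 0" for v using c fin by simp
      have "c x = 0"
      proof (rule ccontr)
        assume cx: "c x \<noteq> 0"
        have "f x v = (\<Sum>b'\<in>B. (- c b' / c x) * f b' v)" for v
        proof -
          have "f x v = - (\<Sum>b\<in>B. c b * f b v) / c x"
            using eq[of v] cx by (simp add: field_simps eq_neg_iff_add_eq_0)
          also have "\<dots> = (\<Sum>b'\<in>B. (- c b' / c x) * f b' v)"
            by (simp add: sum_negf[symmetric] sum_divide_distrib)
          finally show ?thesis .
        qed
        then have "\<exists>d. \<forall>v. f x v = (\<Sum>b'\<in>B. d b' * f b' v)"
          by (intro exI[of _ "\<lambda>b'. - c b' / c x"]) blast
        then show False using False by blast
      qed
      then show ?thesis using ind[of c] eq by auto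
    qed
    ultimately show ?thesis using B(1) by (intro exI[of _ "insert x B"] exI[of _ Q]) auto
  qed
qed auto

abbreviation Ps :: "nat \<Rightarrow> (idx list \<times> idx list) set" where
  "Ps n \<equiv> {p. length (fst p) + length (snd p) = n}"

lemma finite_Ps [simp]: "finite (Ps n)"
  by (rule finite_subset[of _ "(\<Union>k\<le>n. Ls k) \<times> (\<Union>k\<le>n. Ls k)"]) auto

lemma sum_Ps: "(\<Sum>p\<in>Ps n. f p) = (\<Sum>k\<le>n. \<Sum>a\<in>Ls k. \<Sum>b\<in>Ls (n - k). f (a, b))"
proof -
  have "(\<Sum>k\<le>n. \<Sum>a\<in>Ls k. \<Sum>b\<in>Ls (n - k). f (a, b)) = (\<Sum>k\<le>n. \<Sum>p\<in>Ls k \<times> Ls (n - k). f p)"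
    by (simp add: sum.cartesian_product)
  also have "\<dots> = (\<Sum>p\<in>(\<Union>k\<le>n. Ls k \<times> Ls (n - k)). f p)"
    by (rule sum.UNION_disjoint[symmetric]) auto
  also have "(\<Union>k\<le>n. Ls k \<times> Ls (n - k)) = Ps n" by auto
  finally show ?thesis by simp
qed

lemma Delta_Nil_left: "Delta act w ([], b) = (if w = b then 1 else 0)"
proof (induction w arbitrary: b)
  case (Cons x w)
  then show ?case by (cases b) auto
qed simp

section \<open>Coproduct, and the kernel as a coideal\<close>

context group_braiding
begin

text \<open>The value of a bilinear form \<open>F\<close> at the coproduct of \<open>u\<close>.
  Recursion for the coproduct becomes a transformation of \<open>F\<close>, so that inductions never
  touch the double sum.\<close>

definition ED :: "idx list \<Rightarrow> (idx list \<Rightarrow> idx list \<Rightarrow> 'k) \<Rightarrow> 'k" where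
  "ED u F = (\<Sum>p\<in>Ps (length u). Delta act u p * F (fst p) (snd p))"

lemma ED_Nil: "ED [] F = F [] []"
proof -
  have "Ps 0 = {([], [])}" by auto
  then show ?thesis by (simp add: ED_def)
qed

lemma ED_Cons:
  "ED (y # u) F = ED u (\<lambda>a b. F (y # a) b + (\<Sum>a'\<in>Ls (length a). gc y a a' * F a' (y # b)))"
proof -
  let ?n = "length u"
  have 1: "(\<Sum>p\<in>Ps (Suc ?n). (if fst p \<noteq> [] \<and> hd (fst p) = y then Delta act u (tl (fst p), snd p) else 0) * F (fst p) (snd p))
     = (\<Sum>p\<in>Ps ?n. Delta act u p * F (y # fst p) (snd p))" (is "sum ?f _ = _")
  proof -
    have "sum ?f (Ps (Suc ?n)) = sum ?f ((\<lambda>p. (y # fst p, snd p)) ` Ps ?n)"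
    proof (rule sum.mono_neutral_right)
      show "\<forall>p\<in>Ps (Suc ?n) - (\<lambda>p. (y # fst p, snd p)) ` Ps ?n. ?f p = 0"
      proof
        fix p assume p: "p \<in> Ps (Suc ?n) - (\<lambda>p. (y # fst p, snd p)) ` Ps ?n"
        have False if "fst p \<noteq> []" "hd (fst p) = y"
        proof -
          have "p = (y # tl (fst p), snd p)" using that by (metis list.collapse prod.collapse)
          moreover have "(tl (fst p), snd p) \<in> Ps ?n" using p that by (cases "fst p") auto
          ultimately show False using p by (metis (no_types, lifting) DiffE fst_conv snd_conv image_eqI)
        qed
        then show "?f p = 0" by auto
      qed
    qed auto
    also have "\<dots> = (\<Sum>p\<in>Ps ?n. Delta act u p * F (y # fst p) (snd p))"
      by (subst sum.reindex) (auto simp: inj_on_def prod_eq_iff intro!: sum.cong)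
    finally show ?thesis .
  qed
  have 2: "(\<Sum>p\<in>Ps (Suc ?n). (if snd p \<noteq> [] \<and> hd (snd p) = y then
        (\<Sum>a'\<in>Ls (length (fst p)). Delta act u (a', tl (snd p)) * gc y a' (fst p)) else 0) * F (fst p) (snd p))
     = (\<Sum>p\<in>Ps ?n. \<Sum>a'\<in>Ls (length (fst p)). Delta act u p * (gc y (fst p) a' * F a' (y # snd p)))" (is "sum ?f _ = _")
  proof -
    have "sum ?f (Ps (Suc ?n)) = sum ?f ((\<lambda>p. (fst p, y # snd p)) ` Ps ?n)"
    proof (rule sum.mono_neutral_right)
      show "\<forall>p\<in>Ps (Suc ?n) - (\<lambda>p. (fst p, y # snd p)) ` Ps ?n. ?f p = 0"
      proof
        fix p assume p: "p \<in> Ps (Suc ?n) - (\<lambda>p. (fst p, y # snd p)) ` Ps ?n"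
        have False if "snd p \<noteq> []" "hd (snd p) = y"
        proof -
          have "p = (fst p, y # tl (snd p))" using that by (metis list.collapse prod.collapse)
          moreover have "(fst p, tl (snd p)) \<in> Ps ?n" using p that by (cases "snd p") auto
          ultimately show False using p by (metis (no_types, lifting) DiffE fst_conv snd_conv image_eqI)
        qed
        then show "?f p = 0" by auto
      qed
    qed auto
    also have "\<dots> = (\<Sum>p\<in>Ps ?n. \<Sum>a'\<in>Ls (length (fst p)). Delta act u (a', snd p) * gc y a' (fst p) * F (fst p) (y # snd p))"
      by (subst sum.reindex) (auto simp: inj_on_def prod_eq_iff sum_distrib_right intro!: sum.cong)
    also have "\<dots> = (\<Sum>p\<in>Ps ?n. \<Sum>a'\<in>Ls (length (fst p)). Delta act u p * (gc y (fst p) a' * F a' (y # snd p)))"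
      by (simp add: sum.Sigma)
        (rule sum.reindex_bij_witness[of _ "\<lambda>(p, a'). ((a', snd p), fst p)" "\<lambda>(p, a'). ((a', snd p), fst p)"]; auto)
    finally show ?thesis .
  qed
  have "ED (y # u) F = (\<Sum>p\<in>Ps ?n. Delta act u p * F (y # fst p) (snd p))
      + (\<Sum>p\<in>Ps ?n. \<Sum>a'\<in>Ls (length (fst p)). Delta act u p * (gc y (fst p) a' * F a' (y # snd p)))"
    unfolding 1[symmetric] 2[symmetric] sum.distrib[symmetric]
    by (simp add: ED_def gc_def distrib_right cong: if_cong)
  then show ?thesis by (simp add: ED_def distrib_left sum.distrib sum_distrib_left)
qed

lemma ED_add: "ED u (\<lambda>a b. F a b + G a b) = ED u F + ED u G"
  by (simp add: ED_def distrib_left sum.distrib)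

text \<open>Multiplicativity on the other side, Delta(u x) = Delta(u) (x \<otimes> 1 + 1 \<otimes>
  x), where \<open>x\<close> turns into g_b(x) on its way past \<open>b\<close>. It matches the
  recursion of the antipode, which treats the last letter.\<close>

lemma ED_snoc:
  "ED (u @ [x]) F = ED u (\<lambda>a b. (\<Sum>z\<in>UNIV. gw act b x z * F (a @ [z]) b) + F a (b @ [x]))"
proof (induction u arbitrary: F)
  case Nil
  have "Ls 0 = {[]}" by auto
  moreover have "(\<Sum>z\<in>UNIV. (if x = z then 1 else 0) * F [z] []) = F [x] []"
    by (simp add: if_distrib[of "\<lambda>x. x * _"] cong: if_cong)
  ultimately show ?case by (simp add: ED_Cons ED_Nil)
next
  case (Cons y u)
  have *: "(\<Sum>z\<in>UNIV. gw act b x z * (\<Sum>a'\<in>Ls (length (a @ [z])). gc y (a @ [z]) a' * F a' (y # b)))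
     = (\<Sum>a'\<in>Ls (length a). gc y a a' * (\<Sum>z\<in>UNIV. gw act (y # b) x z * F (a' @ [z]) (y # b)))" for a b
  proof -
    have "(\<Sum>z\<in>UNIV. gw act b x z * (\<Sum>a'\<in>Ls (length (a @ [z])). gc y (a @ [z]) a' * F a' (y # b)))
       = (\<Sum>z\<in>UNIV. \<Sum>a'\<in>Ls (length a). \<Sum>t\<in>UNIV. gw act b x z * (gc y a a' * act y z t * F (a' @ [t]) (y # b)))"
      by (simp add: sum_Ls_Suc_snoc sum_distrib_left gc_snoc)
    also have "\<dots> = (\<Sum>a'\<in>Ls (length a). \<Sum>z\<in>UNIV. \<Sum>t\<in>UNIV. gw act b x z * (gc y a a' * act y z t * F (a' @ [t]) (y # b)))"
      by (rule sum.swap)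
    also have "\<dots> = (\<Sum>a'\<in>Ls (length a). \<Sum>t\<in>UNIV. \<Sum>z\<in>UNIV. gw act b x z * (gc y a a' * act y z t * F (a' @ [t]) (y # b)))"
      by (intro sum.cong refl sum.swap)
    finally show ?thesis by (simp add: sum_distrib_left sum_distrib_right mult_ac)
  qed
  show ?case
    unfolding append_Cons ED_Cons Cons
    by (rule arg_cong[where f = "ED u"], intro ext)
      (simp add: distrib_left sum.distrib * del: gw.simps length_append)
qed

text \<open>Cutting words in two is the coproduct on the shuffle side. The left tensor factor is
  paired with the suffix \<open>w2\<close>: a letter landing in \<open>w1\<close> acts on
  \<open>w2\<close>, just as a letter joining the right factor \<open>b\<close> acts on the left
  factor \<open>a\<close>.\<close>

lemma phi_tensor: "phi act u (w1 @ w2) = ED u (\<lambda>a b. phi act b w1 * phi act a w2)"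
proof (induction u arbitrary: w1 w2)
  case Nil
  show ?case by (cases w1) (simp_all add: ED_Nil)
next
  case (Cons y u)
  let ?P = "Ps (length u)"
  have 1: "(\<lambda>v. phi act u (w1 @ v)) = (\<lambda>v. \<Sum>p\<in>?P. (Delta act u p * phi act (snd p) w1) * phi act (fst p) v)" for w1
    by (simp add: Cons ED_def mult_ac)
  have 2: "(\<lambda>x. gact act y w2 (\<lambda>v. phi act u (x @ v)))
     = (\<lambda>x. \<Sum>p\<in>?P. (Delta act u p * gact act y w2 (phi act (fst p))) * phi act (snd p) x)"
    unfolding 1 flin_sum[OF flin_gact] by (simp add: mult_ac)
  have "phi act (y # u) (w1 @ w2)
     = (\<Sum>p\<in>?P. (Delta act u p * phi act (snd p) w1) * phi act (y # fst p) w2)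
       + (\<Sum>p\<in>?P. (Delta act u p * gact act y w2 (phi act (fst p))) * phi act (y # snd p) w1)"
    unfolding phi.simps shuf_she_append 1[of w1] 2 flin_sum[OF flin_shuf2] ..
  then show ?case
    by (simp add: ED_Cons ED_add)
      (simp add: ED_def gact_phi sum_distrib_left sum_distrib_right mult_ac)
qed

definition kerI :: "nat \<Rightarrow> (idx list \<Rightarrow> 'k) set" where
  "kerI n = {u. hom n u \<and> (\<forall>v. (\<Sum>w\<in>Ls n. u w * phi act w v) = 0)}"

lemma kerI_sum: "u \<in> kerI n \<Longrightarrow> flin T \<Longrightarrow> (\<Sum>w\<in>Ls n. u w * T (phi act w)) = 0"
  by (simp add: kerI_def flin_sum[symmetric] flin_zero)

text \<open>Rewriting the right factor in a basis \<open>B\<close> of the images gives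
  \<open>A\<close>, and independence of \<open>B\<close> forces each \<open>A b\<close> into the
  kernel; the difference \<open>C\<close> is killed on the right because it compares two expansions
  of the same vector. So the kernel of a tensor product of maps splits as for vector spaces.\<close>

lemma kernel_decomposition:
  assumes D: "\<And>w1 w2. (\<Sum>a\<in>Ls k. \<Sum>b\<in>Ls m. D a b * (phi act b w1 * phi act a w2)) = 0"
  shows "\<exists>A C. (\<forall>b. A b \<in> kerI k) \<and> (\<forall>a. C a \<in> kerI m)
     \<and> (\<forall>a\<in>Ls k. \<forall>b\<in>Ls m. D a b = A b a + C a b)"
proof -
  obtain B P where B: "B \<subseteq> Ls m"
    and P: "\<And>b v. b \<in> Ls m \<Longrightarrow> phi act b v = (\<Sum>b'\<in>B. P b b' * phi act b' v)"
    and ind: "\<And>c b. (\<And>v. (\<Sum>b\<in>B. c b * phi act b v) = 0) \<Longrightarrow> b \<in> B \<Longrightarrow> c b = 0"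
    using independent_subfamily[of "Ls m" "phi act"] by auto
  define A where "A b a = (if a \<in> Ls k \<and> b \<in> B then \<Sum>b0\<in>Ls m. D a b0 * P b0 b else 0)" for a b
  define C where "C a b = (if a \<in> Ls k \<and> b \<in> Ls m then D a b - A b a else 0)" for a b
  have "A b \<in> kerI k" for b
  proof (cases "b \<in> B")
    case True
    have "(\<Sum>a\<in>Ls k. A b a * phi act a w2) = 0" for w2
    proof (rule ind[of "\<lambda>b. \<Sum>a\<in>Ls k. A b a * phi act a w2", OF _ True])
      fix w1
      have "(\<Sum>b\<in>B. (\<Sum>a\<in>Ls k. A b a * phi act a w2) * phi act b w1)
          = (\<Sum>b\<in>B. \<Sum>a\<in>Ls k. \<Sum>b0\<in>Ls m. D a b0 * phi act a w2 * (P b0 b * phi act b w1))"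
        by (simp add: A_def sum_distrib_left sum_distrib_right mult_ac)
      also have "\<dots> = (\<Sum>a\<in>Ls k. \<Sum>b\<in>B. \<Sum>b0\<in>Ls m. D a b0 * phi act a w2 * (P b0 b * phi act b w1))"
        by (rule sum.swap)
      also have "\<dots> = (\<Sum>a\<in>Ls k. \<Sum>b0\<in>Ls m. \<Sum>b\<in>B. D a b0 * phi act a w2 * (P b0 b * phi act b w1))"
        by (intro sum.cong refl sum.swap)
      also have "\<dots> = (\<Sum>a\<in>Ls k. \<Sum>b0\<in>Ls m. D a b0 * (phi act b0 w1 * phi act a w2))"
        by (intro sum.cong refl) (simp add: P[of _ w1] sum_distrib_left sum_distrib_right mult_ac)
      finally show "(\<Sum>b\<in>B. (\<Sum>a\<in>Ls k. A b a * phi act a w2) * phi act b w1) = 0"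
        by (simp add: D)
    qed
    then show ?thesis by (simp add: kerI_def hom_def A_def)
  qed (simp add: kerI_def hom_def A_def)
  moreover have "C a \<in> kerI m" for a
  proof (cases "a \<in> Ls k")
    case True
    have "(\<Sum>b\<in>Ls m. C a b * phi act b v) = 0" for v
    proof -
      have "(\<Sum>b\<in>Ls m. A b a * phi act b v) = (\<Sum>b\<in>B. A b a * phi act b v)"
        using B by (intro sum.mono_neutral_right) (auto simp: A_def)
      also have "\<dots> = (\<Sum>b\<in>B. \<Sum>b0\<in>Ls m. D a b0 * (P b0 b * phi act b v))"
        using True by (simp add: A_def sum_distrib_left sum_distrib_right mult_ac)
      also have "\<dots> = (\<Sum>b0\<in>Ls m. \<Sum>b\<in>B. D a b0 * (P b0 b * phi act b v))"
        by (rule sum.swap)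
      also have "\<dots> = (\<Sum>b0\<in>Ls m. D a b0 * phi act b0 v)"
        by (intro sum.cong refl) (simp add: P[of _ v] sum_distrib_left)
      finally show ?thesis using True by (simp add: C_def left_diff_distrib sum_subtractf)
    qed
    then show ?thesis by (simp add: kerI_def hom_def C_def)
  qed (simp add: kerI_def hom_def C_def)
  moreover have "\<forall>a\<in>Ls k. \<forall>b\<in>Ls m. D a b = A b a + C a b" by (simp add: C_def)
  ultimately show ?thesis by blast
qed

lemma sum_ED:
  "(\<Sum>w\<in>Ls n. u w * ED w F) = (\<Sum>k\<le>n. \<Sum>a\<in>Ls k. \<Sum>b\<in>Ls (n - k). Delta_lin act u (a, b) * F a b)"
proof -
  have "(\<Sum>w\<in>Ls n. u w * ED w F) = (\<Sum>p\<in>Ps n. \<Sum>w\<in>Ls n. u w * (Delta act w p * F (fst p) (snd p)))"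
    by (subst sum.swap) (simp add: ED_def sum_distrib_left)
  also have "\<dots> = (\<Sum>p\<in>Ps n. Delta_lin act u p * F (fst p) (snd p))"
    by (intro sum.cong refl) (simp add: Delta_lin_def sum_distrib_left sum_distrib_right mult_ac)
  finally show ?thesis by (simp add: sum_Ps)
qed

lemma kerI_coideal:
  assumes u: "u \<in> kerI n"
  shows "\<exists>A C. \<forall>k\<le>n. (\<forall>b. A k b \<in> kerI k) \<and> (\<forall>a. C k a \<in> kerI (n - k))
     \<and> (\<forall>a\<in>Ls k. \<forall>b\<in>Ls (n - k). Delta_lin act u (a, b) = A k b a + C k a b)"
proof -
  have "\<exists>A C. (\<forall>b. A b \<in> kerI k) \<and> (\<forall>a. C a \<in> kerI (n - k))
     \<and> (\<forall>a\<in>Ls k. \<forall>b\<in>Ls (n - k). Delta_lin act u (a, b) = A b a + C a b)" if k: "k \<le> n" for k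
  proof (rule kernel_decomposition)
    fix w1 w2
    let ?s = "\<lambda>k. \<Sum>a\<in>Ls k. \<Sum>b\<in>Ls (n - k). Delta_lin act u (a, b) * (phi act b w1 * phi act a w2)"
    \<comment> \<open>Since \<open>phi\<close> preserves length, fixing \<open>w1\<close> and
      \<open>w2\<close> singles out one bidegree of the coproduct.\<close>
    have 0: "?s k = 0" if "length w2 \<noteq> k \<or> length w1 \<noteq> n - k" for k
      using that by (intro sum.neutral ballI) (auto simp: phi_0)
    have "(\<Sum>k\<le>n. ?s k) = (\<Sum>w\<in>Ls n. u w * phi act w (w1 @ w2))"
      by (simp add: sum_ED[symmetric] phi_tensor)
    also have "\<dots> = 0" using u by (simp add: kerI_def)
    finally have all: "(\<Sum>k\<le>n. ?s k) = 0" .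
    show "?s k = 0"
    proof (cases "length w2 \<noteq> k \<or> length w1 \<noteq> n - k")
      case False
      then have "(\<Sum>k\<in>{..n} - {k}. ?s k) = 0"
        by (intro sum.neutral ballI 0) auto
      then show ?thesis using all k sum.remove[of "{..n}" k ?s] by simp
    qed (rule 0)
  qed
  then show ?thesis by metis
qed

section \<open>Compatibility with the antipode\<close>

definition psi :: "idx list \<Rightarrow> idx list \<Rightarrow> 'k" where
  "psi b v = (\<Sum>x\<in>Ls (length b). Srev act (rev b) x * phi act x v)"

lemma psi_snoc: "psi (b @ [x]) v = - (\<Sum>y\<in>UNIV. gw act b x y * shuf act v (she y) (psi b))"
proof -
  have "psi b = (\<lambda>v. \<Sum>x\<in>Ls (length b). Srev act (rev b) x * phi act x v)"
    by (simp add: psi_def fun_eq_iff)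
  then have "shuf act v (she y) (psi b) = (\<Sum>x\<in>Ls (length b). Srev act (rev b) x * shuf act v (she y) (phi act x))" for y
    by (simp add: flin_sum[OF flin_shuf2])
  then show ?thesis
    by (simp add: psi_def sum_Ls_Suc sum_distrib_left sum_negf mult_ac)
qed

text \<open>For \<open>u = u0 @ [x]\<close> every term a \<otimes> b of Delta(u0) contributes a
  g_b(x) \<otimes> b and a \<otimes> b x. As S(b x) = - g_b(x) S(b), the two cancel pair by pair
  after multiplication.\<close>

lemma ED_antipode:
  assumes "u \<noteq> []" shows "ED u (\<lambda>a b. shuf act v (phi act a) (psi b)) = 0"
proof -
  obtain u0 x where u: "u = u0 @ [x]" using assms by (metis rev_exhaust)
  have 1: "shuf act v (phi act (a @ [z])) (psi b) = shuf act v (phi act a) (\<lambda>v. shuf act v (she z) (psi b))" for a z b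
    by (simp add: phi_append shuf_assoc)
  have 2: "shuf act v (phi act a) (psi (b @ [x]))
      = - (\<Sum>y\<in>UNIV. gw act b x y * shuf act v (phi act a) (\<lambda>v. shuf act v (she y) (psi b)))" for a b
  proof -
    have "psi (b @ [x]) = (\<lambda>v. (- 1) * (\<Sum>y\<in>UNIV. gw act b x y * shuf act v (she y) (psi b)))"
      by (simp add: psi_snoc fun_eq_iff)
    then have "shuf act v (phi act a) (psi (b @ [x]))
      = (- 1) * shuf act v (phi act a) (\<lambda>v. \<Sum>y\<in>UNIV. gw act b x y * shuf act v (she y) (psi b))"
      by (simp only: flin_scale[OF flin_shuf2])
    then show ?thesis by (simp add: flin_sum[OF flin_shuf2])
  qed
  show ?thesis unfolding u ED_snoc 1 2 by (simp add: ED_def)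
qed

lemma kerI_0: "u \<in> kerI 0 \<Longrightarrow> u = (\<lambda>_. 0)"
proof
  fix w assume u: "u \<in> kerI 0"
  have L: "Ls 0 = {[]}" by auto
  have "(\<Sum>w\<in>Ls 0. u w * phi act w []) = 0" using u unfolding kerI_def by blast
  then have "u [] = 0" unfolding L by simp
  then show "u w = 0" using u by (cases w) (auto simp: kerI_def hom_def)
qed

lemma sum_S_lin: "(\<Sum>v\<in>Ls n. S_lin act u v * phi act v x) = (\<Sum>w\<in>Ls n. u w * psi w x)"
proof -
  have "(\<Sum>v\<in>Ls n. S_lin act u v * phi act v x) = (\<Sum>v\<in>Ls n. \<Sum>w\<in>Ls n. u w * (Srev act (rev w) v * phi act v x))"
    by (simp add: S_lin_def sum_distrib_left sum_distrib_right mult_ac)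
  also have "\<dots> = (\<Sum>w\<in>Ls n. \<Sum>v\<in>Ls n. u w * (Srev act (rev w) v * phi act v x))"
    by (rule sum.swap)
  finally show ?thesis by (simp add: psi_def sum_distrib_left)
qed

text \<open>Applying multiplication after \<open>id \<otimes> S\<close> to the coproduct of \<open>u\<close> gives zero; all terms but \<open>S(u)\<close>
  lie in the kernel by the coideal property and the induction hypothesis.\<close>

lemma kerI_antipode: "u \<in> kerI n \<Longrightarrow> S_lin act u \<in> kerI n"
proof (induction n arbitrary: u rule: less_induct)
  case (less n)
  show ?case
  proof (cases "n = 0")
    case True
    then have "u = (\<lambda>_. 0)" using kerI_0 less.prems by simp
    then show ?thesis by (simp add: S_lin_def kerI_def hom_def)
  next
    case False
    obtain A C where AC: "\<And>k b. k \<le> n \<Longrightarrow> A k b \<in> kerI k" "\<And>k a. k \<le> n \<Longrightarrow> C k a \<in> kerI (n - k)"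
      "\<And>k a b. k \<le> n \<Longrightarrow> a \<in> Ls k \<Longrightarrow> b \<in> Ls (n - k) \<Longrightarrow> Delta_lin act u (a, b) = A k b a + C k a b"
      using kerI_coideal[OF less.prems] by metis
    have "(\<Sum>w\<in>Ls n. u w * psi w v) = 0" for v
    proof -
      let ?F = "\<lambda>a b. shuf act v (phi act a) (psi b)"
      let ?s = "\<lambda>k. \<Sum>a\<in>Ls k. \<Sum>b\<in>Ls (n - k). Delta_lin act u (a, b) * ?F a b"
      \<comment> \<open>In positive left degree \<open>A\<close> dies in the first factor, and
        \<open>C\<close> has degree \<open>n - k < n\<close>, where the induction hypothesis
        applies. Left degree 0 contributes only 1 \<otimes> u.\<close>
      have s: "?s k = 0" if k: "k \<in> {..n} - {0}" for k
      proof -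
        have "?s k = (\<Sum>a\<in>Ls k. \<Sum>b\<in>Ls (n - k). A k b a * ?F a b) + (\<Sum>a\<in>Ls k. \<Sum>b\<in>Ls (n - k). C k a b * ?F a b)"
          unfolding sum.distrib[symmetric] using AC(3)[of k] k
          by (intro sum.cong refl) (simp add: distrib_right)
        also have "(\<Sum>a\<in>Ls k. \<Sum>b\<in>Ls (n - k). A k b a * ?F a b) = (\<Sum>b\<in>Ls (n - k). \<Sum>a\<in>Ls k. A k b a * ?F a b)"
          by (rule sum.swap)
        also have "\<dots> = 0"
        proof (rule sum.neutral, rule ballI)
          fix b
          show "(\<Sum>a\<in>Ls k. A k b a * ?F a b) = 0"
            using kerI_sum[OF AC(1)[of k b] flin_shuf1[of act v "psi b"]] k by simp
        qed
        also have "(\<Sum>a\<in>Ls k. \<Sum>b\<in>Ls (n - k). C k a b * ?F a b) = 0"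
        proof (rule sum.neutral, rule ballI)
          fix a
          have "S_lin act (C k a) \<in> kerI (n - k)" using less.IH[of "n - k"] AC(2) k False by auto
          then have 0: "(\<lambda>x. \<Sum>b\<in>Ls (n - k). C k a b * psi b x) = (\<lambda>x. 0)"
            by (simp add: sum_S_lin[symmetric] kerI_def)
          show "(\<Sum>b\<in>Ls (n - k). C k a b * ?F a b) = 0"
            using flin_sum[OF flin_shuf2[of act v "phi act a"], of "C k a" psi "Ls (n - k)"] by (simp add: 0)
        qed
        finally show ?thesis by simp
      qed
      have "(\<Sum>k\<le>n. ?s k) = (\<Sum>w\<in>Ls n. u w * ED w ?F)" by (simp add: sum_ED)
      also have "\<dots> = 0" using False by (intro sum.neutral ballI) (auto simp: ED_antipode)
      finally have "?s 0 = 0" using sum.remove[of "{..n}" 0 ?s] s by simp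
      moreover have "Delta_lin act u ([], b) = u b" if "b \<in> Ls n" for b
      proof -
        have "Delta_lin act u ([], b) = (\<Sum>w\<in>Ls n. if w = b then u w else 0)"
          using that by (simp add: Delta_lin_def Delta_Nil_left if_distrib[of "\<lambda>x. _ * x"] cong: if_cong)
        then show ?thesis using that by simp
      qed
      moreover have "Ls 0 = {[]}" by auto
      ultimately show ?thesis by simp
    qed
    moreover have "hom n (S_lin act u)"
      using less.prems by (auto simp: hom_def S_lin_def kerI_def intro!: sum.neutral)
    ultimately show ?thesis by (simp add: kerI_def sum_S_lin)
  qed
qed

section \<open>Ideal property, and finiteness from vanishing words\<close>

lemma hom_tmult: "hom m t \<Longrightarrow> hom n u \<Longrightarrow> hom (m + n) (tmult t u)"
  unfolding hom_def tmult_def by (intro allI impI sum.neutral ballI) (metis append_take_drop_id length_append mult_eq_0_iff)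

lemma sum_tmult:
  assumes "hom m t" "hom n u"
  shows "(\<Sum>v\<in>Ls (m + n). tmult t u v * phi act v x)
     = (\<Sum>a\<in>Ls m. \<Sum>b\<in>Ls n. t a * (u b * shuf act x (phi act a) (phi act b)))"
proof -
  have *: "tmult t u v = t (take m v) * u (drop m v)" if "v \<in> Ls (m + n)" for v
  proof -
    have "tmult t u v = (\<Sum>k\<in>{m}. t (take k v) * u (drop k v))"
      unfolding tmult_def using that assms(1)
      by (intro sum.mono_neutral_right) (auto simp: hom_def)
    then show ?thesis by simp
  qed
  have "(\<Sum>v\<in>Ls (m + n). tmult t u v * phi act v x) = (\<Sum>v\<in>Ls (m + n). t (take m v) * u (drop m v) * phi act v x)"
    by (simp add: *)
  also have "\<dots> = (\<Sum>(a, b)\<in>Ls m \<times> Ls n. t a * u b * phi act (a @ b) x)"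
    by (rule sum.reindex_bij_witness[of _ "\<lambda>(a, b). a @ b" "\<lambda>v. (take m v, drop m v)"]) auto
  finally show ?thesis by (simp add: sum.cartesian_product phi_append mult_ac)
qed

lemma kerI_tmult:
  assumes "u \<in> kerI n" "hom m t" shows "tmult t u \<in> kerI (m + n)" "tmult u t \<in> kerI (n + m)"
proof -
  have u: "hom n u" using assms(1) by (simp add: kerI_def)
  show "tmult t u \<in> kerI (m + n)"
    using hom_tmult[OF assms(2) u] kerI_sum[OF assms(1) flin_shuf2]
    by (simp add: kerI_def sum_tmult[OF assms(2) u] sum_distrib_left[symmetric])
  have "(\<Sum>a\<in>Ls n. \<Sum>b\<in>Ls m. u a * (t b * shuf act x (phi act a) (phi act b))) =
     (\<Sum>b\<in>Ls m. t b * (\<Sum>a\<in>Ls n. u a * shuf act x (phi act a) (phi act b)))" for x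
    by (subst sum.swap) (simp add: sum_distrib_left mult_ac)
  then show "tmult u t \<in> kerI (n + m)"
    using hom_tmult[OF u assms(2)] kerI_sum[OF assms(1) flin_shuf1]
    by (simp add: kerI_def sum_tmult[OF u assms(2)])
qed

lemma kerI_1: "u \<in> kerI 1 \<Longrightarrow> u = (\<lambda>_. 0)"
proof
  fix w assume u: "u \<in> kerI 1"
  have L: "Ls 0 = {[]}" by auto
  have "u [j] = 0" for j
  proof -
    have "(\<Sum>w\<in>Ls 1. u w * phi act w [j]) = 0" using u unfolding kerI_def by blast
    then show ?thesis by (simp add: sum_Ls_Suc L if_distrib[of "\<lambda>x. _ * x"] cong: if_cong)
  qed
  then show "u w = 0" using u by (cases w rule: list.exhaust; cases "tl w") (auto simp: kerI_def hom_def)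
qed

lemma hopf_ideal_kerI: "hopf_ideal_fam act kerI"
  unfolding hopf_ideal_fam_def
proof (intro conjI allI ballI impI)
  fix n and u :: "idx list \<Rightarrow> 'k"
  show "(\<lambda>_. 0) \<in> kerI n" by (simp add: kerI_def hom_def)
  show "hom n u" if "u \<in> kerI n" using that by (simp add: kerI_def)
  show "(\<lambda>w. u w + v w) \<in> kerI n" if "u \<in> kerI n" "v \<in> kerI n" for v
    using that by (simp add: kerI_def hom_def distrib_right sum.distrib)
  show "(\<lambda>w. c * u w) \<in> kerI n" if "u \<in> kerI n" for c
    using that by (simp add: kerI_def hom_def mult.assoc sum_distrib_left[symmetric])
  show "u = (\<lambda>_. 0)" if "n < 2 \<and> u \<in> kerI n"
    using that kerI_0[of u] kerI_1[of u] by (cases n) (auto simp: less_Suc_eq numeral_2_eq_2)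
  show "u [] = 0" if "u \<in> kerI n"
    using that kerI_0[of u] by (cases n) (auto simp: kerI_def hom_def)
  show "S_lin act u \<in> kerI n" if "u \<in> kerI n" using that by (rule kerI_antipode)
  show "tmult t u \<in> kerI (m + n)" "tmult u t \<in> kerI (n + m)" if "u \<in> kerI n \<and> hom m t" for m t
    using that kerI_tmult by blast+
  show "in_span ({tens a t | a t k m. a \<in> kerI k \<and> hom m t} \<union> {tens t a | a t k m. a \<in> kerI k \<and> hom m t})
      (Delta_lin act u)" (is "in_span ?S _") if u: "u \<in> kerI n"
  proof -
    obtain A C where AC: "\<And>k b. k \<le> n \<Longrightarrow> A k b \<in> kerI k" "\<And>k a. k \<le> n \<Longrightarrow> C k a \<in> kerI (n - k)"
      "\<And>k a b. k \<le> n \<Longrightarrow> a \<in> Ls k \<Longrightarrow> b \<in> Ls (n - k) \<Longrightarrow> Delta_lin act u (a, b) = A k b a + C k a b"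
      using kerI_coideal[OF u] by metis
    \<comment> \<open>Indicator tensors of single words turn the identity between coefficients into
      a finite sum of pure tensors.\<close>
    define e where "e b v = (if v = b then 1 else 0 :: 'k)" for b v :: "idx list"
    have e: "hom (length b) (e b)" for b by (auto simp: hom_def e_def)
    have "Delta_lin act u = (\<lambda>p. \<Sum>k\<in>{..n}. (\<Sum>b\<in>Ls (n - k). tens (A k b) (e b) p) + (\<Sum>a\<in>Ls k. tens (e a) (C k a) p))"
    proof
      fix p :: "idx list \<times> idx list"
      obtain v1 v2 where p: "p = (v1, v2)" by force
      have "(\<Sum>b\<in>Ls (n - k). tens (A k b) (e b) p) = (if v2 \<in> Ls (n - k) then A k v2 v1 else 0)" for k
        by (simp add: tens_def e_def p if_distrib[of "\<lambda>x. _ * x"] cong: if_cong)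
      moreover have "(\<Sum>a\<in>Ls k. tens (e a) (C k a) p) = (if v1 \<in> Ls k then C k v1 v2 else 0)" for k
        by (simp add: tens_def e_def p if_distrib[of "\<lambda>x. x * _"] cong: if_cong)
      moreover have "A k v2 v1 = 0" if "k \<le> n" "v1 \<notin> Ls k" for k
        using AC(1)[of k v2] that by (simp add: kerI_def hom_def)
      moreover have "C k v1 v2 = 0" if "k \<le> n" "v2 \<notin> Ls (n - k)" for k
        using AC(2)[of k v1] that by (simp add: kerI_def hom_def)
      ultimately have "(\<Sum>k\<in>{..n}. (\<Sum>b\<in>Ls (n - k). tens (A k b) (e b) p) + (\<Sum>a\<in>Ls k. tens (e a) (C k a) p))
        = (\<Sum>k\<in>{..n}. if k = length v1 then (if length v2 = n - k then Delta_lin act u p else 0) else 0)"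
        using AC(3)[of "length v1" v1 v2] by (intro sum.cong refl) (auto simp: p)
      also have "\<dots> = Delta_lin act u p"
      proof -
        have "Delta_lin act u p = 0" if "length v1 + length v2 \<noteq> n"
          using that u by (auto simp: p Delta_lin_def kerI_def hom_def intro!: sum.neutral)
        then show ?thesis by auto
      qed
      finally show "Delta_lin act u p = (\<Sum>k\<in>{..n}. (\<Sum>b\<in>Ls (n - k). tens (A k b) (e b) p) + (\<Sum>a\<in>Ls k. tens (e a) (C k a) p))"
        by simp
    qed
    moreover have "in_span ?S (\<lambda>p. \<Sum>k\<in>{..n}. (\<Sum>b\<in>Ls (n - k). tens (A k b) (e b) p) + (\<Sum>a\<in>Ls k. tens (e a) (C k a) p))"
      using AC(1,2) e by (intro in_span_sum in_span_add in_span_base) blast+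
    ultimately show ?thesis by simp
  qed
qed

text \<open>\<open>nichols_J\<close> contains every Hopf ideal, in particular \<open>kerI\<close>,
  and \<open>kerI n\<close> is all of degree \<open>n\<close> once \<open>phi\<close> kills every
  word of length \<open>n\<close>.\<close>

lemma nichols_fin_dimI:
  assumes "\<And>w v. N \<le> length w \<Longrightarrow> phi act w v = 0"
  shows "nichols_fin_dim act"
  unfolding nichols_fin_dim_def
proof (intro exI[of _ N] allI impI)
  fix n and u :: "idx list \<Rightarrow> 'k" assume n: "N \<le> n" and "hom n u"
  then have "u \<in> kerI n" using assms by (simp add: kerI_def)
  then show "u \<in> nichols_J act n"
    unfolding nichols_J_def using hopf_ideal_kerI by (auto intro: in_span_base)
qed

end

section \<open>Skew derivations on the quantum shuffle algebra\<close>

definition nul :: "(idx list, 'k::field) lop \<Rightarrow> bool" where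
  "nul R \<longleftrightarrow> (\<forall>f. app R f [] = 0)"

lemma nul_add: "nul R \<Longrightarrow> nul S \<Longrightarrow> nul (R + S)"
  by (simp add: nul_def app_ring)

lemma nul_diff: "nul R \<Longrightarrow> nul S \<Longrightarrow> nul (R - S)"
  by (simp add: nul_def app_ring)

lemma nul_smul: "nul R \<Longrightarrow> nul (c \<bullet> R)"
  by (simp add: nul_def smul.rep_eq)

lemma nul_mult: "nul R \<Longrightarrow> nul (R * S)"
  by (simp add: nul_def app_ring)

lemma nul_power: "nul R \<Longrightarrow> 0 < n \<Longrightarrow> nul (R ^ n)"
  by (cases n) (simp_all add: nul_mult)

lemmas nul_intros = nul_add nul_diff nul_smul nul_mult nul_power

lift_definition Xop :: "'k::field brd \<Rightarrow> idx \<Rightarrow> (idx list, 'k) lop" is "\<lambda>act i f v. shuf act v (she i) f"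
  using flin_shuf2 unfolding flin_def by blast

lift_definition Gop :: "'k::field brd \<Rightarrow> idx \<Rightarrow> (idx list, 'k) lop" is "\<lambda>act i f v. gact act i v f"
  using flin_gact unfolding flin_def by blast

lift_definition Dop :: "idx \<Rightarrow> (idx list, 'k::field) lop" is "\<lambda>i f v. f (i # v)"
  by simp

lift_definition Kop :: "(idx \<Rightarrow> 'k::field) \<Rightarrow> (idx list, 'k) lop" is "\<lambda>\<chi> f w. prod_list (map \<chi> w) * f w"
  by (simp add: algebra_simps)

lemma lop_sum_app: "app (\<Sum>i\<in>I. f i) u w = (\<Sum>i\<in>I. app (f i) u w)"
  by (induction I rule: infinite_finite_induct) (simp_all add: app_ring)

text \<open>The twist in \<open>shuf\<close> sits on the second factor, so removal of a letter
  passes \<open>x_i\<close> without any scalar and the group element appears only in the correction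
  term.\<close>

lemma D_X: "Dop j * Xop act i = Xop act i * Dop j + (if i = j then Gop act i else 0)"
  by (rule lop_eqI) (simp add: app_ring Dop.rep_eq Xop.rep_eq Gop.rep_eq)

lemma D_K: "Dop i * Kop \<chi> = \<chi> i \<bullet> (Kop \<chi> * Dop i)"
  by (rule lop_eqI) (simp add: app_ring Dop.rep_eq Kop.rep_eq smul.rep_eq)

lemma K_K: "Kop \<chi> * Kop \<chi>' = Kop (\<lambda>i. \<chi> i * \<chi>' i :: 'k::field)"
proof (rule lop_eqI)
  fix f :: "idx list \<Rightarrow> 'k" and w :: "idx list"
  have "prod_list (map (\<lambda>i. \<chi> i * \<chi>' i) w) = prod_list (map \<chi> w) * prod_list (map \<chi>' w)"
    by (induction w) (simp_all add: mult_ac)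
  then show "app (Kop \<chi> * Kop \<chi>') f w = app (Kop (\<lambda>i. \<chi> i * \<chi>' i)) f w"
    by (simp add: app_ring Kop.rep_eq)
qed

lemma K_1: "Kop (\<lambda>_. 1 :: 'k::field) = 1"
proof (rule lop_eqI)
  fix f :: "idx list \<Rightarrow> 'k" and w :: "idx list"
  have "prod_list (map (\<lambda>_. 1) w) = (1 :: 'k)" by (induction w) simp_all
  then show "app (Kop (\<lambda>_. 1)) f w = app 1 f w" by (simp add: app_ring Kop.rep_eq)
qed

lemma nul_X: "nul (Xop act i)"
  by (simp add: nul_def Xop.rep_eq)

lemma nul_K: "nul R \<Longrightarrow> nul (Kop \<chi> * R)"
  by (simp add: nul_def app_ring Kop.rep_eq)

lemma phi_Xop: "phi act w = app (prod_list (map (Xop act) w)) sh1"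
  by (induction w) (simp_all add: app_ring Xop.rep_eq)

text \<open>The coefficient of \<open>app R f\<close> at \<open>i # w\<close> is that of
  \<open>app (Dop i * R) f\<close> at \<open>w\<close>. Because \<open>f\<close> is arbitrary, the
  right factor \<open>T\<close> is absorbed into it and the induction on words goes on inside
  \<open>C\<close>.\<close>

lemma lop_zeroI:
  assumes "R \<in> C"
    and C: "\<And>R. R \<in> C \<Longrightarrow> nul R" "\<And>R i. R \<in> C \<Longrightarrow> \<exists>R'\<in>C. \<exists>T. Dop i * R = R' * T"
  shows "R = 0"
proof (rule lop_eqI)
  fix f w
  have "app R f w = 0"
    using assms(1)
  proof (induction w arbitrary: R f)
    case Nil
    then show ?case using C(1) by (simp add: nul_def)
  next
    case (Cons i w)
    obtain R' T where "R' \<in> C" "Dop i * R = R' * T" using C(2)[OF Cons.prems] by blast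
    moreover have "app R f (i # w) = app (Dop i * R) f w" by (simp add: app_ring Dop.rep_eq)
    ultimately show ?case using Cons.IH by (simp add: app_ring)
  qed
  then show "app R f w = app 0 f w" by (simp add: app_ring)
qed

context group_braiding
begin

lemma G_X: "Gop act i * Xop act j = (\<Sum>k\<in>UNIV. act i j k \<bullet> (Xop act k * Gop act i))"
proof (rule lop_eqI)
  fix f w
  have "app (Gop act i * Xop act j) f w = (\<Sum>k\<in>UNIV. act i j k * shuf act w (she k) (\<lambda>v. gact act i v f))"
    by (simp add: app_ring Gop.rep_eq Xop.rep_eq gact_shuf gact_she flin_sum[OF flin_shuf1])
  then show "app (Gop act i * Xop act j) f w = app (\<Sum>k\<in>UNIV. act i j k \<bullet> (Xop act k * Gop act i)) f w"
    by (simp add: lop_sum_app smul.rep_eq app_ring Gop.rep_eq Xop.rep_eq)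
qed

lemma K_G:
  assumes "\<And>i j k. act i k j \<noteq> 0 \<Longrightarrow> \<chi> k = \<chi> j"
  shows "Kop \<chi> * Gop act i = Gop act i * Kop \<chi>"
proof (rule lop_eqI)
  fix f w
  have "prod_list (map \<chi> w) * gact act i w f = gact act i w (\<lambda>v. prod_list (map \<chi> v) * f v)"
  proof (induction w arbitrary: f)
    case (Cons j w)
    have "gact act i (j # w) (\<lambda>v. prod_list (map \<chi> v) * f v)
       = (\<Sum>k\<in>UNIV. act i k j * (\<chi> k * (prod_list (map \<chi> w) * gact act i w (\<lambda>v. f (k # v)))))"
      by (simp add: mult.assoc flin_scale[OF flin_gact] Cons[symmetric])
    also have "\<dots> = (\<Sum>k\<in>UNIV. act i k j * (\<chi> j * (prod_list (map \<chi> w) * gact act i w (\<lambda>v. f (k # v)))))"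
      using assms by (intro sum.cong refl) (metis mult_eq_0_iff)
    finally show ?case by (simp add: sum_distrib_left mult_ac)
  qed simp
  then show "app (Kop \<chi> * Gop act i) f w = app (Gop act i * Kop \<chi>) f w"
    by (simp add: app_ring Kop.rep_eq Gop.rep_eq)
qed

lemma K_X:
  assumes "\<And>i j k. act i k j \<noteq> 0 \<Longrightarrow> \<chi> k = \<chi> j"
  shows "Kop \<chi> * Xop act i = \<chi> i \<bullet> (Xop act i * Kop \<chi>)"
proof (rule lop_eqI)
  fix f w
  have "prod_list (map \<chi> w) * shuf act w (she i) f = \<chi> i * shuf act w (she i) (\<lambda>v. prod_list (map \<chi> v) * f v)"
  proof (induction w arbitrary: f)
    case (Cons j w)
    have G: "gact act i w (\<lambda>v. prod_list (map \<chi> v) * f v) = prod_list (map \<chi> w) * gact act i w f"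
    proof -
      have "app (Kop \<chi> * Gop act i) f w = app (Gop act i * Kop \<chi>) f w" using K_G assms by metis
      then show ?thesis by (simp add: app_ring Kop.rep_eq Gop.rep_eq)
    qed
    have "shuf act w (she i) (\<lambda>v. \<chi> j * prod_list (map \<chi> v) * f (j # v))
        = \<chi> j * shuf act w (she i) (\<lambda>v. prod_list (map \<chi> v) * f (j # v))"
      by (simp add: mult.assoc flin_scale[OF flin_shuf2])
    then show ?case
      using Cons[of "\<lambda>v. f (j # v)"] G by (cases "i = j") (simp_all add: algebra_simps del: shuf.simps)
  qed simp
  then show "app (Kop \<chi> * Xop act i) f w = app (\<chi> i \<bullet> (Xop act i * Kop \<chi>)) f w"
    by (simp add: app_ring Kop.rep_eq Xop.rep_eq smul.rep_eq)
qed

end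

text \<open>Simplification nests products to the right, where a rule for \<open>a * b\<close> does
  not match inside \<open>a * (b * r)\<close>; this produces the companion rule.\<close>

lemma mult_assoc_rule: "(a :: 'o::semigroup_mult) * b = c \<Longrightarrow> a * (b * r) = c * r"
  by (simp add: mult.assoc[symmetric])

text \<open>The braiding is normalised to \<open>q\<^sub>1\<^sub>2 = 1\<close>, and \<open>sg\<close> stands for \<open>q\<^sub>1\<^sub>2 q\<^sub>2\<^sub>1\<close>. The operators \<open>g\<close> and \<open>h\<close>
  are the automorphisms by which the block and the point act in the braiding.\<close>

locale block_point =
  fixes x1 x2 x3 d1 d2 d3 g h :: "(idx list, 'k::field) lop" and eps sg q a :: 'k
  assumes d_x: "d1 * x1 = x1 * d1 + g" "d1 * x2 = x2 * d1" "d1 * x3 = x3 * d1"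
      "d2 * x1 = x1 * d2" "d2 * x2 = x2 * d2 + g" "d2 * x3 = x3 * d2"
      "d3 * x1 = x1 * d3" "d3 * x2 = x2 * d3" "d3 * x3 = x3 * d3 + h"
    and g_x: "g * x1 = eps \<bullet> (x1 * g)" "g * x2 = eps \<bullet> (x2 * g) + x1 * g" "g * x3 = x3 * g"
    and h_x: "h * x1 = sg \<bullet> (x1 * h)" "h * x2 = sg \<bullet> (x2 * h) + (sg * a) \<bullet> (x1 * h)" "h * x3 = q \<bullet> (x3 * h)"
    and nul_x: "nul x1" "nul x2" "nul x3"
    and zeroI: "\<And>R T1 T2 T3. nul R \<Longrightarrow> d1 * R = R * T1 \<Longrightarrow> d2 * R = R * T2 \<Longrightarrow> d3 * R = R * T3 \<Longrightarrow> R = 0"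
    and char: "prime CHAR('k)" "CHAR('k) > 2"
begin

lemmas mv = d_x g_x h_x d_x[THEN mult_assoc_rule] g_x[THEN mult_assoc_rule] h_x[THEN mult_assoc_rule]

lemma two: "(2 :: 'k) \<noteq> 0"
proof
  assume "(2 :: 'k) = 0"
  then have "(of_nat 2 :: 'k) = 0" by simp
  then have "CHAR('k) dvd 2" by (simp only: of_nat_eq_0_iff_char_dvd)
  then show False using char(2) by (auto dest: dvd_imp_le)
qed

lemma half_add [simp]: "(1 / 2 :: 'k) \<bullet> R + (1 / 2 :: 'k) \<bullet> R = R"
  "(1 / 2 :: 'k) \<bullet> R + ((1 / 2 :: 'k) \<bullet> R + S) = R + S"
  using two by (simp_all add: lop.scale_left_distrib[symmetric] add.assoc[symmetric])

lemma two_smul: "(2 :: 'k) \<bullet> R = R + R"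
  by (metis lop.scale_left_distrib lop.scale_one one_add_one)

lemma square_zeroI: "z * z = - (z * z) \<Longrightarrow> z * z = (0 :: (idx list, 'k) lop)"
proof -
  assume "z * z = - (z * z)"
  then have "(1 / 2 :: 'k) \<bullet> (z * z) + (1 / 2 :: 'k) \<bullet> (z * z) = 0"
    by (metis lop.scale_minus_right add.right_inverse)
  then show ?thesis by simp
qed

end

section \<open>Leibniz rule and powers in characteristic p\<close>

lemma mult_of_nat_left_commute: "x * (of_nat n * y) = of_nat n * (x * y :: 'o::semiring_1)"
  by (metis mult.assoc mult_of_nat_commute)

lemma of_nat_char_dvd_lop: "CHAR('k) dvd n \<Longrightarrow> of_nat n * (R :: ('a, 'k::field) lop) = 0"
  by (auto simp: dvd_def mult.assoc lop_char)

lemma skew_derivation_power: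
  fixes z :: "'o::ring_1"
  assumes "d * z = z * d + v" "v * z = z * v"
  shows "d * z ^ Suc n = z ^ Suc n * d + of_nat (Suc n) * (z ^ n * v)"
proof (induction n)
  case (Suc n)
  have v: "v * z ^ m = z ^ m * v" for m
    using assms(2) by (metis power_commuting_commutes)
  have "d * z ^ Suc (Suc n) = z * (d * z ^ Suc n) + v * z ^ Suc n"
    unfolding power_Suc[of _ "Suc n"] mult.assoc[symmetric] assms(1) distrib_right ..
  also have "\<dots> = z ^ Suc (Suc n) * d + (of_nat (Suc n) * (z ^ Suc n * v) + z ^ Suc n * v)"
    unfolding Suc v distrib_left mult_of_nat_left_commute by (simp add: mult.assoc add.assoc)
  finally show ?case by (simp add: algebra_simps)
qed (simp add: assms)

text \<open>The derivative of a \<open>p\<close>-th power carries the factor \<open>p\<close>. This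
  is how \<open>p\<close>-th powers are fed into the vanishing criterion.\<close>

lemma skew_derivation_char:
  fixes z :: "('a, 'k::field) lop"
  assumes "d * z = z * d + v" "v * z = z * v" "CHAR('k) > 0"
  shows "d * z ^ CHAR('k) = z ^ CHAR('k) * d"
proof -
  obtain m where m: "CHAR('k) = Suc m" using assms(3) by (cases "CHAR('k)") auto
  show ?thesis
    using skew_derivation_power[OF assms(1,2), of m] lop_char[of "z ^ m * v"] by (simp add: m)
qed

text \<open>The formal derivative \<open>n x\<^sup>n\<^sup>-\<^sup>1\<close> of \<open>x\<^sup>n\<close>, without truncated subtraction.\<close>

primrec dpow :: "'o::ring_1 \<Rightarrow> nat \<Rightarrow> 'o" where
  "dpow x 0 = 0"
| "dpow x (Suc n) = x ^ n + x * dpow x n"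

lemma dpow_eq: "dpow x (Suc n) = of_nat (Suc n) * x ^ n"
proof (induction n)
  case (Suc n)
  have "dpow x (Suc (Suc n)) = x ^ Suc n + of_nat (Suc n) * x ^ Suc n"
    unfolding dpow.simps(2)[of x "Suc n"] Suc mult_of_nat_left_commute power_Suc[symmetric] ..
  also have "\<dots> = of_nat (Suc (Suc n)) * x ^ Suc n"
    unfolding of_nat_Suc[of "Suc n"] distrib_right by simp
  finally show ?case .
qed simp

lemma dpow_char: "CHAR('k) > 0 \<Longrightarrow> dpow (x :: ('a, 'k::field) lop) CHAR('k) = 0"
  using dpow_eq[of x "CHAR('k) - 1"] lop_char[of "x ^ (CHAR('k) - 1)"] by simp

context block_point
begin

lemma char_pos: "CHAR('k) > 0"
  using char(2) by simp

primrec zs :: "nat \<Rightarrow> (idx list, 'k) lop" where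
  "zs 0 = x3"
| "zs (Suc n) = x2 * zs n - (eps ^ n) \<bullet> (zs n * x2)"

text \<open>For \<open>sg = 1\<close>, \<open>xi n * h\<close> is the \<open>d3\<close>-derivative
  of \<open>zs n\<close>; \<open>x2 + a \<bullet> x1\<close> is what \<open>x2\<close> becomes when
  \<open>h\<close> moves to its right.\<close>

primrec xi :: "nat \<Rightarrow> (idx list, 'k) lop" where
  "xi 0 = 1"
| "xi (Suc n) = x2 * xi n - (eps ^ n) \<bullet> (xi n * (x2 + a \<bullet> x1))"

lemma nul_zs: "nul (zs n)"
  by (induction n) (auto intro!: nul_intros nul_x)

lemma zs_zero: assumes "zs m = 0" shows "m \<le> n \<Longrightarrow> zs n = 0"
  by (induction n rule: dec_induct) (simp_all add: assms)

end

section \<open>Weak interaction: \<open>sg = 1\<close>\<close>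

locale weak_point = block_point x1 x2 x3 d1 d2 d3 g h eps 1 q a
  for x1 x2 x3 d1 d2 d3 g h :: "(idx list, 'k::field) lop" and eps q a :: 'k +
  assumes eps_sq: "eps * eps = 1"
begin

lemma eps_pow_sq: "eps ^ n * eps ^ n = 1" "eps ^ n * (eps ^ n * c) = c"
  by (simp_all add: power_mult_distrib[symmetric] eps_sq mult.assoc[symmetric])

lemma d_zs: "d1 * zs n = zs n * d1" "d3 * zs n = zs n * d3 + xi n * h"
proof (induction n)
  case (Suc n)
  note r = mv Suc Suc[THEN mult_assoc_rule]
  show "d1 * zs (Suc n) = zs (Suc n) * d1"
    by (simp add: r algebra_simps)
  show "d3 * zs (Suc n) = zs (Suc n) * d3 + xi (Suc n) * h"
    by (simp add: r algebra_simps lop.scale_right_distrib)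
qed (simp_all add: d_x)

text \<open>Moving \<open>g\<close> or \<open>h\<close> past \<open>x2\<close> adds a multiple of
  \<open>x1\<close>, and the extra term is the braided commutator of \<open>x1\<close> with some
  \<open>zs m\<close>. Only \<open>m < n\<close> is assumed, because for the super Jordan block this
  hypothesis is itself proved by an induction that uses the present lemma.\<close>

lemma gh_zs:
  assumes "\<And>m. m < n \<Longrightarrow> x1 * zs m = (eps ^ m) \<bullet> (zs m * x1)"
  shows "g * zs n = (eps ^ n) \<bullet> (zs n * g)" "h * zs n = q \<bullet> (zs n * h)"
proof -
  have "g * zs n = (eps ^ n) \<bullet> (zs n * g) \<and> h * zs n = q \<bullet> (zs n * h)"
    using assms
  proof (induction n)
    case (Suc n)
    then have IH: "g * zs n = (eps ^ n) \<bullet> (zs n * g)" "h * zs n = q \<bullet> (zs n * h)" 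
      "x1 * zs n = (eps ^ n) \<bullet> (zs n * x1)" by auto
    note r = mv IH IH[THEN mult_assoc_rule]
    show ?case
      by (simp add: r algebra_simps lop.scale_right_distrib lop.scale_right_diff_distrib eps_pow_sq)
  qed (simp add: g_x h_x)
  then show "g * zs n = (eps ^ n) \<bullet> (zs n * g)" "h * zs n = q \<bullet> (zs n * h)" by auto
qed

lemma d2_zs:
  assumes "\<And>m. m < n \<Longrightarrow> x1 * zs m = (eps ^ m) \<bullet> (zs m * x1)"
  shows "d2 * zs n = zs n * d2"
  using assms
proof (induction n)
  case (Suc n)
  then have IH: "d2 * zs n = zs n * d2" "g * zs n = (eps ^ n) \<bullet> (zs n * g)" using gh_zs[of n] by auto
  note r = mv IH IH[THEN mult_assoc_rule]
  show ?case
    by (simp add: r algebra_simps lop.scale_right_distrib)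
qed (simp add: d_x)

context
  assumes x1_zs: "\<And>n. x1 * zs n = (eps ^ n) \<bullet> (zs n * x1)"
    and xi_zs: "\<And>i j. xi i * zs j = (eps ^ (i * j)) \<bullet> (zs j * xi i)"
    and q_sq: "q * q = 1"
begin

lemmas zmv = d_zs d2_zs[OF x1_zs] gh_zs[OF x1_zs] xi_zs d_zs[THEN mult_assoc_rule]
  d2_zs[OF x1_zs, THEN mult_assoc_rule] gh_zs[OF x1_zs, THEN mult_assoc_rule] xi_zs[THEN mult_assoc_rule]

text \<open>Only \<open>d3\<close> gives correction terms, in \<open>zs i * xi j * h\<close> and
  \<open>zs j * xi i * h\<close>; they cancel because \<open>q\<close> and
  \<open>eps ^ (i * j)\<close> both square to 1.\<close>

lemma zs_commute: "zs i * zs j = (q * eps ^ (i * j)) \<bullet> (zs j * zs i)"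
proof -
  define E where "E = eps ^ (i * j)"
  have E: "eps ^ (i * j) = E" "eps ^ (j * i) = E" by (simp_all add: E_def mult.commute)
  have s: "E * (E * c) = c" "q * (q * c) = c" "E * E = 1" for c
    by (simp_all add: E_def eps_pow_sq q_sq mult.assoc[symmetric])
  let ?R = "zs i * zs j - (q * E) \<bullet> (zs j * zs i)"
  have "?R = 0"
  proof (rule zeroI)
    show "nul ?R" by (intro nul_intros nul_zs)
    show "d1 * ?R = ?R * d1" by (simp add: zmv algebra_simps)
    show "d2 * ?R = ?R * d2" by (simp add: zmv algebra_simps)
    show "d3 * ?R = ?R * d3"
      by (simp add: zmv E algebra_simps lop.scale_right_distrib s q_sq)
  qed
  then show ?thesis by (simp add: E)
qed

text \<open>The scalar by which \<open>zs i\<close> commutes with itself squares to 1. If it is 1,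
  then \<open>zs i\<close> commutes with its derivative and the \<open>p\<close>-th power vanishes;
  if it is - 1, the square vanishes because 2 is invertible.\<close>

lemma zs_nilpotent: "nilp {zs i}"
proof (cases "q * eps ^ (i * i) = 1")
  case True
  let ?y = "xi i * h"
  have y: "?y * zs i = zs i * ?y" using True by (simp add: zmv mult.assoc)
  have "zs i ^ CHAR('k) = 0"
  proof (rule zeroI)
    show "nul (zs i ^ CHAR('k))" using char_pos by (intro nul_power nul_zs)
    show "d1 * zs i ^ CHAR('k) = zs i ^ CHAR('k) * d1" "d2 * zs i ^ CHAR('k) = zs i ^ CHAR('k) * d2"
      by (rule power_commuting_commutes[symmetric], simp add: zmv)+
    show "d3 * zs i ^ CHAR('k) = zs i ^ CHAR('k) * d3"
      using zmv(2) y char_pos by (rule skew_derivation_char)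
  qed
  then show ?thesis by (rule nilp_singleton)
next
  case False
  have "(q * eps ^ (i * i)) * (q * eps ^ (i * i)) = 1"
    using eps_pow_sq(1)[of "i * i"] q_sq by (metis mult.assoc mult.left_commute mult.right_neutral)
  then have "q * eps ^ (i * i) = - 1" using False by (metis square_eq_1_iff)
  then have "zs i * zs i = - (zs i * zs i)" using zs_commute[of i i] by (metis lop_smul_uminus)
  then have "zs i ^ 2 = 0" using square_zeroI by (simp add: power2_eq_square)
  then show ?thesis by (rule nilp_singleton)
qed

lemma nilp_zs: "nilp (zs ` {..<n})"
  by (rule nilp_skew_commuting) (use zs_nilpotent zs_commute in blast)+

lemma nilp_all:
  assumes "zs P = 0" "P \<noteq> 0" "nilp {x1, x2}"
  shows "nilp {x1, x2, x3}"
proof -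
  \<comment> \<open>\<open>zs i\<close> has degree \<open>i + 1\<close>, so
    \<open>zs (Suc i)\<close> has exactly the weight required of \<open>x2 * zs i\<close>.\<close>
  let ?Z = "(\<lambda>i. (zs i, Suc i)) ` {..<P}"
  have "nilp ({x1, x2} \<union> fst ` ?Z)"
  proof (rule nilp_pbw[where P = P])
    show "nilp (fst ` ?Z)" using nilp_zs[of P] by (simp add: image_image)
    fix x z w assume x: "x \<in> {x1, x2}" and "(z, w) \<in> ?Z"
    then obtain i where i: "i < P" "z = zs i" "w = Suc i" by auto
    have Zi: "(zs i, Suc i) \<in> ?Z" using i by auto
    have *: "zs i * y \<in> lop.span (pbw_terms {x1, x2} ?Z (Suc w))" if "y \<in> {x1, x2}" for y
      using pbw_zx[OF Zi that] i by (intro lop.span_base) simp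
    have S: "zs (Suc i) \<in> lop.span (pbw_terms {x1, x2} ?Z (Suc w))"
    proof (cases "Suc i < P")
      case True
      then have "(zs (Suc i), Suc (Suc i)) \<in> ?Z" by blast
      from pbw_z[OF this, of "Suc w"] show ?thesis
        using i by (intro lop.span_base) (simp del: zs.simps)
    next
      case False
      then have "zs (Suc i) = 0" using i zs_zero[OF assms(1), of "Suc i"] by simp
      then show ?thesis by (simp only: lop.span_zero)
    qed
    have "x2 * zs i = zs (Suc i) + (eps ^ i) \<bullet> (zs i * x2)" by simp
    then show "x * z \<in> lop.span (pbw_terms {x1, x2} ?Z (Suc w))"
      using x i(2) S x1_zs[of i] by (auto simp del: zs.simps intro!: lop.span_add lop.span_scale *)
  qed (use assms(3) in auto)
  moreover have "x3 \<in> fst ` ?Z" using assms(2) by (force intro: image_eqI[of _ _ 0])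
  then have "{x1, x2, x3} \<subseteq> {x1, x2} \<union> fst ` ?Z" by blast
  ultimately show ?thesis by (rule nilp_subset)
qed

end

end

section \<open>Jordan block\<close>

lemma skew_derivation_cube:
  fixes z :: "('a, 'k::field) lop"
  assumes "d * z = z * d + y" "y * z = q \<bullet> (z * y)" "1 + q + q * q = 0"
  shows "d * z ^ 3 = z ^ 3 * d"
proof -
  have "d * z ^ 3 = z ^ 3 * d + (z * (z * y) + z * (y * z) + (y * z) * z)"
    by (simp add: power3_eq_cube assms(1) assms(1)[THEN mult_assoc_rule] algebra_simps)
  also have "z * (z * y) + z * (y * z) + (y * z) * z = (1 + q + q * q) \<bullet> (z * (z * y))"
    by (simp add: assms(2) mult.assoc lop.scale_left_distrib)
  finally show ?thesis by (simp add: assms(3))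
qed

locale jordan_point = weak_point x1 x2 x3 d1 d2 d3 g h 1 q a
  for x1 x2 x3 d1 d2 d3 g h :: "(idx list, 'k::field) lop" and q a :: 'k
begin

lemma jordan: "x2 * x1 = x1 * x2 - (1 / 2) \<bullet> (x1 * x1)"
proof -
  let ?R = "x2 * x1 - x1 * x2 + (1 / 2) \<bullet> (x1 * x1)"
  have "?R = 0"
  proof (rule zeroI)
    show "nul ?R" by (intro nul_intros nul_x)
    show "d1 * ?R = ?R * d1" by (simp add: mv algebra_simps)
    show "d2 * ?R = ?R * d2" by (simp add: mv algebra_simps)
    show "d3 * ?R = ?R * d3" by (simp add: mv algebra_simps)
  qed
  then show ?thesis by (simp add: algebra_simps eq_neg_iff_add_eq_0)
qed

lemmas jv = jordan jordan[THEN mult_assoc_rule]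

lemma x1_power: "x1 ^ CHAR('k) = 0"
proof (rule zeroI)
  show "nul (x1 ^ CHAR('k))" using char_pos by (intro nul_power nul_x)
  show "d2 * x1 ^ CHAR('k) = x1 ^ CHAR('k) * d2" "d3 * x1 ^ CHAR('k) = x1 ^ CHAR('k) * d3"
    by (rule power_commuting_commutes[symmetric], simp add: d_x)+
  show "d1 * x1 ^ CHAR('k) = x1 ^ CHAR('k) * d1"
    by (rule skew_derivation_char[OF d_x(1) _ char_pos]) (simp add: g_x)
qed

text \<open>\<open>V n\<close> stands for \<open>(n choose 2) x\<^sub>2\<^sup>n\<^sup>-\<^sup>2\<close>.\<close>

primrec V :: "nat \<Rightarrow> (idx list, 'k) lop" where
  "V 0 = 0"
| "V (Suc n) = dpow x2 n + x2 * V n"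

lemma V_eq: "V (Suc (Suc n)) = of_nat (Suc (Suc n) choose 2) * x2 ^ n"
proof (induction n)
  case 0
  then show ?case by (simp add: numeral_2_eq_2)
next
  case (Suc n)
  have c: "(Suc (Suc (Suc n)) choose 2) = Suc (Suc n) + (Suc (Suc n) choose 2)"
    by (simp add: numeral_2_eq_2)
  show ?case
    unfolding V.simps(2)[of "Suc (Suc n)"] Suc dpow_eq c of_nat_add distrib_right
      mult_of_nat_left_commute power_Suc[symmetric] ..
qed

text \<open>Moving \<open>g\<close> past \<open>x2\<close> replaces it by \<open>x2 + x1\<close>. In
  the Jordan plane the ordered expansion of the \<open>n\<close>-th power of this sum stops at
  second order in \<open>x1\<close>, the cubic terms cancelling.\<close>

lemma g_x2_power: "g * x2 ^ n = (x2 ^ n + x1 * dpow x2 n + (1 / 2) \<bullet> (x1 * (x1 * V n))) * g"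
proof (induction n)
  case (Suc n)
  have "g * x2 ^ Suc n = (x2 + x1) * (g * x2 ^ n)"
    by (simp add: mv algebra_simps)
  \<comment> \<open>Naming half of this term lets the factors 1/2 cancel by addition alone.\<close>
  moreover obtain H where "x1 * (x1 * (dpow x2 n * g)) = H + H" by (metis half_add(1))
  ultimately show ?case unfolding Suc
    by (simp add: jv algebra_simps lop.scale_right_distrib)
qed simp

lemma d2_x2_power: "d2 * x2 ^ n = x2 ^ n * d2 + (dpow x2 n + x1 * V n) * g"
proof (induction n)
  case (Suc n)
  have "d2 * x2 ^ Suc n = x2 * (d2 * x2 ^ n) + g * x2 ^ n"
    by (simp add: mv algebra_simps)
  then show ?case unfolding Suc g_x2_power
    by (simp add: jv algebra_simps lop.scale_right_distrib)
qed simp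

text \<open>The \<open>d2\<close>-derivative has coefficients \<open>p\<close> and
  \<open>p choose 2\<close>; the latter is a multiple of \<open>p\<close> because \<open>p\<close>
  is odd.\<close>

lemma x2_power: "x2 ^ CHAR('k) = 0"
proof (rule zeroI)
  show "nul (x2 ^ CHAR('k))" using char_pos by (intro nul_power nul_x)
  show "d1 * x2 ^ CHAR('k) = x2 ^ CHAR('k) * d1" "d3 * x2 ^ CHAR('k) = x2 ^ CHAR('k) * d3"
    by (rule power_commuting_commutes[symmetric], simp add: d_x)+
  obtain m where m: "CHAR('k) = Suc (Suc m)"
    using char(2) by (metis Suc_lessE numeral_2_eq_2)
  have "CHAR('k) dvd (CHAR('k) choose 2)"
  proof -
    have "odd CHAR('k)" using char prime_odd_nat by blast
    then obtain k where "CHAR('k) = Suc (2 * k)" by (metis oddE Suc_eq_plus1)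
    then have "(CHAR('k) choose 2) = CHAR('k) * k" by (simp add: choose_two)
    then show ?thesis by simp
  qed
  then have "dpow x2 CHAR('k) = 0" "V CHAR('k) = 0"
    using lop_char[of "x2 ^ Suc m"] of_nat_char_dvd_lop[of "CHAR('k) choose 2" "x2 ^ m"]
    unfolding m dpow_eq V_eq by (simp_all only:)
  then show "d2 * x2 ^ CHAR('k) = x2 ^ CHAR('k) * d2" by (simp add: d2_x2_power)
qed

lemma nilp_block: "nilp {x1, x2}"
proof -
  have "nilp ({x2} \<union> fst ` {(x1, 1::nat)})"
  proof (rule nilp_pbw[where P = 1])
    show "nilp {x2}" using x2_power by (rule nilp_singleton)
    show "nilp (fst ` {(x1, 1::nat)})" using nilp_singleton[OF x1_power] by simp
    fix x z and w :: nat assume "x \<in> {x2}" "(z, w) \<in> {(x1, 1::nat)}"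
    then have *: "x = x2" "z = x1" "w = 1" by auto
    show "x * z \<in> lop.span (pbw_terms {x2} {(x1, 1)} (Suc w))"
      unfolding * jordan
      by (intro pbw_span lop.span_base pbw_zx[of _ 1] pbw_zz[of _ 1 _ _ 1]) auto
  qed auto
  then show ?thesis by (simp add: insert_commute)
qed

text \<open>The commutator of \<open>x1\<close> and \<open>x2\<close> is a multiple of
  \<open>x1 * x1\<close>, which commutes with \<open>zs n\<close> by the induction
  hypothesis.\<close>

lemma x1_zs: "x1 * zs n = zs n * x1"
proof (induction n)
  case 0
  let ?R = "x1 * x3 - x3 * x1"
  have "?R = 0"
  proof (rule zeroI)
    show "nul ?R" by (intro nul_intros nul_x)
    show "d1 * ?R = ?R * d1" "d2 * ?R = ?R * d2" "d3 * ?R = ?R * d3"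
      by (simp_all add: mv algebra_simps)
  qed
  then show ?case by simp
next
  case (Suc n)
  have s: "x1 * x2 = x2 * x1 + (1 / 2) \<bullet> (x1 * x1)" by (simp add: jordan)
  show ?case
    by (simp add: algebra_simps Suc Suc[THEN mult_assoc_rule])
      (simp add: s s[THEN mult_assoc_rule] algebra_simps Suc Suc[THEN mult_assoc_rule] lop.scale_right_distrib)
qed

lemma x2_x1_power: "x2 * x1 ^ n = x1 ^ n * x2 - (of_nat n / 2) \<bullet> (x1 ^ Suc n)"
proof (induction n)
  case (Suc n)
  have "x2 * x1 ^ Suc n = x1 * (x2 * x1 ^ n) - (1 / 2) \<bullet> (x1 * (x1 * x1 ^ n))"
    by (simp add: jv algebra_simps)
  then show ?case unfolding Suc
    by (simp add: algebra_simps add_divide_distrib lop.scale_left_distrib)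
qed simp

text \<open>In the recursion the terms with \<open>x2\<close> cancel, and the coefficient gets
  multiplied by - (n / 2 + a).\<close>

lemma xi_eq: "\<exists>c. xi n = c \<bullet> (x1 ^ n)"
proof (induction n)
  case 0
  show ?case by (rule exI[of _ 1]) simp
next
  case (Suc n)
  then obtain c where c: "xi n = c \<bullet> (x1 ^ n)" by blast
  have "x1 ^ n * x1 = x1 * x1 ^ n" by (rule power_commutes)
  then have "xi (Suc n) = (- c * (of_nat n / 2) - c * a) \<bullet> (x1 ^ Suc n)"
    by (simp add: c x2_x1_power algebra_simps lop.scale_left_distrib lop.scale_left_diff_distrib
      lop.scale_right_diff_distrib)
  then show ?case by blast
qed

lemma xi_zs: "xi i * zs j = zs j * xi i"
proof -
  obtain c where c: "xi i = c \<bullet> (x1 ^ i)" using xi_eq by blast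
  have "x1 ^ i * zs j = zs j * x1 ^ i" by (rule power_commuting_commutes) (rule x1_zs)
  then show ?thesis by (simp add: c)
qed

lemma zs_eq_0I:
  assumes "xi n = 0" shows "zs n = 0"
proof (rule zeroI)
  show "nul (zs n)" by (rule nul_zs)
  show "d1 * zs n = zs n * d1" "d2 * zs n = zs n * d2" "d3 * zs n = zs n * d3"
    using d_zs[of n] d2_zs[of n] x1_zs assms by simp_all
qed

lemma nilp_linear: assumes "q * q = 1" shows "nilp {x1, x2, x3}"
proof (rule nilp_all)
  show "x1 * zs n = (1 ^ n) \<bullet> (zs n * x1)" for n by (simp add: x1_zs)
  show "xi i * zs j = (1 ^ (i * j)) \<bullet> (zs j * xi i)" for i j by (simp add: xi_zs)
  show "nilp {x1, x2}" by (rule nilp_block)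
  show "CHAR('k) \<noteq> 0" using char by auto
  show "zs CHAR('k) = 0"
    using zs_eq_0I[of "CHAR('k)"] xi_eq[of "CHAR('k)"] x1_power by auto
qed (rule assms)

text \<open>For \<open>2 * a = - 1\<close> the factor - (1 / 2 + a) from \<open>xi 1\<close> to
  \<open>xi 2\<close> is zero, so only \<open>x3\<close> and \<open>zs 1\<close> remain.
  \<open>nilp_linear\<close> asks for \<open>q * q = 1\<close>; with
  \<open>1 + q + q * q = 0\<close> instead, a third generator is adjoined and cubes take the place
  of squares and \<open>p\<close>-th powers.\<close>

lemma nilp_A2:
  assumes om: "1 + q + q * q = 0" and a: "2 * a = - 1"
  shows "nilp {x1, x2, x3}"
proof -
  define z where "z = zs 1"
  have a': "a = - (1 / 2)" using a two by (simp add: field_simps)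
  have "q * q - (- 1 - q) = 0" using om by (simp add: algebra_simps)
  then have qq: "q * q = - 1 - q" by simp
  have x1z: "x1 * z = z * x1" "x1 * x3 = x3 * x1" using x1_zs[of 1] x1_zs[of 0] by (simp_all add: z_def)
  have x1_zs': "x1 * zs m = (1 ^ m) \<bullet> (zs m * x1)" for m by (simp add: x1_zs)
  have gz: "g * z = z * g" "h * z = q \<bullet> (z * h)"
    using gh_zs[OF x1_zs', of 1] by (simp_all add: z_def del: zs.simps)
  have "xi 1 = - (a \<bullet> x1)" by (simp add: algebra_simps)
  then have xi1: "xi 1 = (1 / 2) \<bullet> x1" by (simp only: a' lop.scale_minus_left minus_minus)
  obtain b where b: "xi 1 = b \<bullet> x1" using xi1 by blast
  have dz: "d1 * z = z * d1" "d2 * z = z * d2" "d3 * z = z * d3 + b \<bullet> (x1 * h)"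
    using d_zs[of 1] d2_zs[OF x1_zs', of 1] unfolding b by (simp_all add: z_def del: zs.simps xi.simps)
  have "xi 2 = x2 * xi 1 - xi 1 * (x2 + a \<bullet> x1)" by (simp add: numeral_2_eq_2)
  also have "\<dots> = 0"
    unfolding xi1 by (simp add: a' jv algebra_simps lop.scale_right_diff_distrib)
  finally have z2: "zs 2 = 0" by (rule zs_eq_0I)
  \<comment> \<open>\<open>x3\<close> and \<open>z\<close> generate a Nichols algebra of Cartan type A2, with third root vector \<open>w\<close>.\<close>
  define w where "w = z * x3 - q \<bullet> (x3 * z)"
  note r = mv x1z gz dz x1z[THEN mult_assoc_rule] gz[THEN mult_assoc_rule] dz[THEN mult_assoc_rule]
  have nz: "nul z" by (simp add: z_def nul_zs del: zs.simps)
  have nw: "nul w" unfolding w_def by (intro nul_intros nz nul_x)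
  have dw: "d1 * w = w * d1" "d2 * w = w * d2" "d3 * w = w * d3 + (2 + q) \<bullet> (z * h)"
    by (simp_all add: w_def r qq two_smul algebra_simps lop.scale_right_distrib lop.scale_left_distrib lop.scale_left_diff_distrib)
  have hw: "h * w = (- 1 - q) \<bullet> (w * h)" "x1 * w = w * x1"
    by (simp_all add: w_def r qq algebra_simps lop.scale_right_distrib lop.scale_left_distrib
      lop.scale_left_diff_distrib lop.scale_right_diff_distrib)
  have qs: "q * q = - 1 - q" "q * (q * c) = - c - q * c" for c
    using qq by (simp_all add: mult.assoc[symmetric]) (simp add: algebra_simps)
  note scal = lop.scale_right_distrib lop.scale_left_distrib lop.scale_left_diff_distrib lop.scale_right_diff_distrib qs two_smul
  note r2 = r hw dw hw[THEN mult_assoc_rule] dw[THEN mult_assoc_rule]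
  have zw: "z * w = (- 1 - q) \<bullet> (w * z)"
  proof -
    have "z * w - (- 1 - q) \<bullet> (w * z) = 0" (is "?R = 0")
    proof (rule zeroI)
      show "nul ?R" by (intro nul_intros nw nz)
      show "d1 * ?R = ?R * d1" "d2 * ?R = ?R * d2" by (simp_all add: r2 algebra_simps)
      show "d3 * ?R = ?R * d3" by (simp add: r2 algebra_simps scal)
    qed
    then show ?thesis by simp
  qed
  have zx: "z * x3 = w + q \<bullet> (x3 * z)" by (simp add: w_def)
  have xw: "x3 * w = q \<bullet> (w * x3)"
  proof -
    have "x3 * w - q \<bullet> (w * x3) = 0" (is "?R = 0")
    proof (rule zeroI)
      show "nul ?R" by (intro nul_intros nw nul_x)
      show "d1 * ?R = ?R * d1" "d2 * ?R = ?R * d2" by (simp_all add: r2 algebra_simps)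
      show "d3 * ?R = ?R * d3" by (simp add: r2 zx zx[THEN mult_assoc_rule] algebra_simps scal)
    qed
    then show ?thesis by simp
  qed
  have cube: "y ^ 3 = 0" if "nul y" "d1 * y = y * d1" "d2 * y = y * d2" "d3 * y = y * d3 + v"
      "v * y = q \<bullet> (y * v)" for y v
  proof (rule zeroI)
    show "nul (y ^ 3)" using that(1) by (intro nul_power) simp_all
    show "d1 * y ^ 3 = y ^ 3 * d1" "d2 * y ^ 3 = y ^ 3 * d2"
      by (rule power_commuting_commutes[symmetric], simp add: that)+
    show "d3 * y ^ 3 = y ^ 3 * d3" using that(4,5) om by (rule skew_derivation_cube)
  qed
  have x3: "x3 ^ 3 = 0" by (rule cube[where v = h]) (simp_all add: r nul_x)
  have z3: "z ^ 3 = 0" by (rule cube[where v = "b \<bullet> (x1 * h)"]) (simp_all add: r nz mult.assoc)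
  have w3: "w ^ 3 = 0"
  proof (rule cube[where v = "(2 + q) \<bullet> (z * h)"])
    \<comment> \<open>\<open>- 1 - q\<close> is the square of \<open>q\<close>; moving both
      \<open>z\<close> and \<open>h\<close> past \<open>w\<close> therefore costs the fourth power
      of \<open>q\<close>, which is \<open>q\<close>.\<close>
    have "(- 1 - q) * (- 1 - q) = 1 + q + q * q + q" by (simp add: algebra_simps)
    then have f: "(- 1 - q) * (- 1 - q) = q" using om by simp
    have "(z * h) * w = ((- 1 - q) * (- 1 - q)) \<bullet> (w * (z * h))"
      by (simp only: mult.assoc hw zw[THEN mult_assoc_rule] mult_smul smul_mult lop.scale_scale)
    then have "(z * h) * w = q \<bullet> (w * (z * h))" by (simp only: f)
    then show "(2 + q) \<bullet> (z * h) * w = q \<bullet> (w * (2 + q) \<bullet> (z * h))"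
      by (simp add: mult.commute)
  qed (simp_all add: r2 nw)
  have "nilp ({x3} \<union> fst ` {(w, 1::nat)})"
  proof (rule nilp_pbw[where P = 1])
    show "nilp {x3}" "nilp (fst ` {(w, 1::nat)})" using nilp_singleton x3 w3 by auto
    fix x y and n :: nat assume "x \<in> {x3}" "(y, n) \<in> {(w, 1::nat)}"
    then have *: "x = x3" "y = w" "n = 1" by auto
    show "x * y \<in> lop.span (pbw_terms {x3} {(w, 1)} (Suc n))"
      unfolding * xw by (intro pbw_span lop.span_base pbw_zx[of _ 1]) auto
  qed auto
  then have "nilp (fst ` {(x3, 1::nat), (w, 2)})" by (simp add: insert_commute)
  then have "nilp ({z} \<union> fst ` {(x3, 1::nat), (w, 2)})"
  proof (rule nilp_pbw[where P = 2, rotated])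
    show "nilp {z}" using z3 by (rule nilp_singleton)
    fix x y and n :: nat assume "x \<in> {z}" "(y, n) \<in> {(x3, 1), (w, 2)}"
    then consider "x = z" "y = x3" "n = 1" | "x = z" "y = w" "n = 2" by auto
    then show "x * y \<in> lop.span (pbw_terms {z} {(x3, 1), (w, 2)} (Suc n))"
    proof cases
      case 1
      show ?thesis unfolding 1 zx
        by (intro pbw_span lop.span_base pbw_z[of _ 2] pbw_zx[of _ 1]) auto
    next
      case 2
      show ?thesis unfolding 2 zw
        by (intro pbw_span lop.span_base pbw_zx[of _ 2]) auto
    qed
  qed auto
  then have nZ: "nilp (fst ` {(x3, 1::nat), (z, 2)})" by (rule nilp_subset) auto
  have "nilp ({x1, x2} \<union> fst ` {(x3, 1::nat), (z, 2)})"
  proof (rule nilp_pbw[where P = 2, OF nilp_block nZ])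
    have "zs 2 = x2 * z - z * x2" by (simp add: numeral_2_eq_2 z_def)
    then have x2z: "x2 * x3 = z + x3 * x2" "x2 * z = z * x2"
      using z2 by (simp_all add: z_def)
    fix x y and n :: nat assume "x \<in> {x1, x2}" "(y, n) \<in> {(x3, 1), (z, 2)}"
    then consider "x = x1" "y = x3" "n = 1" | "x = x1" "y = z" "n = 2"
      | "x = x2" "y = x3" "n = 1" | "x = x2" "y = z" "n = 2" by auto
    then show "x * y \<in> lop.span (pbw_terms {x1, x2} {(x3, 1), (z, 2)} (Suc n))"
    proof cases
      case 1
      show ?thesis unfolding 1 x1z by (intro lop.span_base pbw_zx[of _ 1]) auto
    next
      case 2
      show ?thesis unfolding 2 x1z by (intro lop.span_base pbw_zx[of _ 2]) auto
    next
      case 3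
      show ?thesis unfolding 3 x2z
        by (intro pbw_span lop.span_base pbw_z[of _ 2] pbw_zx[of _ 1]) auto
    next
      case 4
      have "z * x2 \<in> pbw_terms {x1, x2} {(x3, 1), (z, 2)} (Suc 2)"
        by (rule pbw_zx[of _ 2]) simp_all
      then show ?thesis unfolding 4(1,2,3) x2z(2) by (rule lop.span_base)
    qed
  next
    fix y and n :: nat assume "(y, n) \<in> {(x3, 1), (z, 2)}"
    then show "1 \<le> n \<and> n \<le> 2" by auto
  qed
  then show ?thesis by (rule nilp_subset) simp
qed

end

section \<open>Super Jordan block\<close>

locale super_block = block_point x1 x2 x3 d1 d2 d3 g h "- 1" sg q a
  for x1 x2 x3 d1 d2 d3 g h :: "(idx list, 'k::field) lop" and sg q a :: 'k
begin

definition y where "y = x2 * x1 + x1 * x2"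

lemma nul_y: "nul y"
  unfolding y_def by (intro nul_intros nul_x)

lemma x1_sq: "x1 * x1 = 0"
  by (rule zeroI[where ?T1.0 = d1 and ?T2.0 = d2 and ?T3.0 = d3]) (simp_all add: mv nul_mult nul_x algebra_simps)

lemma x1_sq': "x1 * (x1 * r) = 0"
  by (simp add: mult.assoc[symmetric] x1_sq)

lemma y_mv: "d1 * y = y * d1 + x1 * g" "d2 * y = y * d2" "d3 * y = y * d3" "g * y = y * g" "x1 * y = y * x1"
  by (simp_all add: y_def mv algebra_simps x1_sq x1_sq')

lemmas ymv = y_mv y_mv[THEN mult_assoc_rule] x1_sq x1_sq' mv

lemma x2_x1: "x2 * x1 = y - x1 * x2"
  by (simp add: y_def)

lemma x2_y: "x2 * y = y * x2 + x1 * y"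
proof -
  have "x2 * y - y * x2 - x1 * y = 0" (is "?R = 0")
  proof (rule zeroI)
    show "nul ?R" by (intro nul_intros nul_x nul_y)
    show "d1 * ?R = ?R * d1" "d2 * ?R = ?R * d2" "d3 * ?R = ?R * d3"
      by (simp_all add: ymv x2_x1 x2_x1[THEN mult_assoc_rule] algebra_simps)
  qed
  then show ?thesis by (simp add: algebra_simps)
qed

lemmas bv = x2_x1 x2_y x2_x1[THEN mult_assoc_rule] x2_y[THEN mult_assoc_rule]

lemma y_power: "y ^ CHAR('k) = 0"
proof (rule zeroI)
  show "nul (y ^ CHAR('k))" using char_pos by (intro nul_power nul_y)
  show "d2 * y ^ CHAR('k) = y ^ CHAR('k) * d2" "d3 * y ^ CHAR('k) = y ^ CHAR('k) * d3"
    by (rule power_commuting_commutes[symmetric], simp add: y_mv)+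
  show "d1 * y ^ CHAR('k) = y ^ CHAR('k) * d1"
    by (rule skew_derivation_char[OF y_mv(1) _ char_pos]) (simp add: ymv mult.assoc)
qed

text \<open>For \<open>eps = - 1\<close> the two terms \<open>x2 * g\<close> in the
  \<open>d2\<close>-derivative of \<open>x2 * x2\<close> cancel and leave \<open>x1 * g\<close>, so
  powers of \<open>x2\<close> are taken in pairs.\<close>

definition t where "t = x2 * x2"

lemma t_mv: "d1 * t = t * d1" "d2 * t = t * d2 + x1 * g" "d3 * t = t * d3" "g * t = (t - y) * g"
  "t * x1 = x1 * t + y * x1" "t * y = y * t + y * y"
  by (simp_all add: t_def ymv bv algebra_simps)

lemmas tmv = t_mv t_mv[THEN mult_assoc_rule] ymv

text \<open>Moving \<open>g\<close> past \<open>t\<close> gives \<open>t - y\<close>. Since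
  \<open>t * y = y * t + y * y\<close>, the expansion of its powers with \<open>y\<close> on the
  left stops after the first order.\<close>

lemma g_t_power: "g * t ^ n = (t ^ n - y * dpow t n) * g"
proof (induction n)
  case (Suc n)
  have "g * t ^ Suc n = (t - y) * (g * t ^ n)" by (simp add: tmv mult.assoc)
  then show ?case unfolding Suc by (simp add: tmv algebra_simps)
qed simp

lemma d2_t_power: "d2 * t ^ n = t ^ n * d2 + x1 * dpow t n * g"
proof (induction n)
  case (Suc n)
  have "d2 * t ^ Suc n = t * (d2 * t ^ n) + x1 * (g * t ^ n)" by (simp add: tmv algebra_simps)
  then show ?case unfolding Suc g_t_power by (simp add: tmv algebra_simps)
qed simp

lemma t_power: "t ^ CHAR('k) = 0"
proof (rule zeroI)
  have "nul t" unfolding t_def by (intro nul_intros nul_x)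
  then show "nul (t ^ CHAR('k))" using char_pos by (intro nul_power)
  show "d1 * t ^ CHAR('k) = t ^ CHAR('k) * d1" "d3 * t ^ CHAR('k) = t ^ CHAR('k) * d3"
    by (rule power_commuting_commutes[symmetric], simp add: t_mv)+
  show "d2 * t ^ CHAR('k) = t ^ CHAR('k) * d2"
    by (simp add: d2_t_power dpow_char char_pos)
qed

lemma nilp_block: "nilp {x1, x2}"
proof -
  have "nilp ({x1} \<union> fst ` {(y, 1::nat)})"
  proof (rule nilp_pbw[where P = 1])
    show "nilp {x1}" using nilp_singleton[of x1 2] x1_sq by (simp add: power2_eq_square)
    show "nilp (fst ` {(y, 1::nat)})" using nilp_singleton[OF y_power] by simp
    fix x z and w :: nat assume "x \<in> {x1}" "(z, w) \<in> {(y, 1::nat)}"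
    then have *: "x = x1" "z = y" "w = 1" by auto
    show "x * z \<in> lop.span (pbw_terms {x1} {(y, 1)} (Suc w))"
      unfolding * y_mv(5) by (intro lop.span_base pbw_zx[of _ 1]) auto
  qed auto
  then have "nilp (fst ` {(x1, 1::nat), (y, 2)})" by (simp add: insert_commute)
  then have "nilp ({x2} \<union> fst ` {(x1, 1::nat), (y, 2)})"
  proof (rule nilp_pbw[where P = 2, rotated])
    have "x2 ^ (2 * CHAR('k)) = 0" using t_power by (simp add: t_def power_mult power2_eq_square)
    then show "nilp {x2}" by (rule nilp_singleton)
    fix x z and w :: nat assume "x \<in> {x2}" "(z, w) \<in> {(x1, 1), (y, 2)}"
    then consider "x = x2" "z = x1" "w = 1" | "x = x2" "z = y" "w = 2" by auto
    then show "x * z \<in> lop.span (pbw_terms {x2} {(x1, 1), (y, 2)} (Suc w))"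
    proof cases
      case 1
      show ?thesis unfolding 1 x2_x1
        by (intro pbw_span lop.span_base pbw_z[of _ 2] pbw_zx[of _ 1]) auto
    next
      case 2
      show ?thesis unfolding 2 x2_y
        by (intro pbw_span lop.span_base pbw_zz[of _ 1 _ _ 2] pbw_zx[of _ 2]) auto
    qed
  qed auto
  then show ?thesis by (rule nilp_subset) auto
qed

end

section \<open>Super Jordan block with weak interaction\<close>

locale super_weak = super_block x1 x2 x3 d1 d2 d3 g h 1 q a + weak_point x1 x2 x3 d1 d2 d3 g h "- 1" q a
  for x1 x2 x3 d1 d2 d3 g h :: "(idx list, 'k::field) lop" and q a :: 'k
begin

lemma h_y: "h * y = y * h"
  by (simp add: y_def mv algebra_simps x1_sq x1_sq')

lemma x2_y_power: "x2 * y ^ n = y ^ n * x2 + of_nat n * (x1 * y ^ n)"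
proof (cases n)
  case (Suc m)
  have c: "x1 * y ^ k = y ^ k * x1" for k
    by (rule power_commuting_commutes[symmetric]) (simp add: y_mv)
  have "y ^ m * (x1 * y) = x1 * y ^ Suc m"
    by (simp only: power_Suc2 mult.assoc[symmetric] c)
  moreover have "x1 * y * y = y * (x1 * y)" by (simp add: ymv mult.assoc)
  \<comment> \<open>\<open>x2\<close> itself plays the part of the derivation: its commutator with
    \<open>y\<close> is \<open>x1 * y\<close>, which commutes with \<open>y\<close>.\<close>
  ultimately show ?thesis
    using skew_derivation_power[OF x2_y, of m] by (simp only: Suc)
qed simp

text \<open>From \<open>y ^ k\<close> the recursion gains a factor \<open>x1\<close> and the scalar
  \<open>k - a\<close>; from \<open>x1 * y ^ k\<close> the definition of \<open>y\<close> and
  \<open>x1 * x1 = 0\<close> give \<open>y ^ Suc k\<close> with scalar 1.\<close>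

lemma xi_eq: "\<exists>c. xi (2 * k) = c \<bullet> (y ^ k)" "\<exists>c. xi (Suc (2 * k)) = c \<bullet> (x1 * y ^ k)"
proof -
  have x1y: "y ^ k * x1 = x1 * y ^ k" for k
    by (rule power_commuting_commutes) (simp add: y_mv)
  have odd: "\<exists>c. xi (Suc (2 * k)) = c \<bullet> (x1 * y ^ k)" if ev: "\<exists>c. xi (2 * k) = c \<bullet> (y ^ k)" for k
  proof -
    obtain c where c: "xi (2 * k) = c \<bullet> (y ^ k)" using ev by blast
    have 1: "xi (Suc (2 * k)) = x2 * xi (2 * k) - xi (2 * k) * (x2 + a \<bullet> x1)" by simp
    have 2: "x2 * y ^ k - y ^ k * (x2 + a \<bullet> x1) = (of_nat k - a) \<bullet> (x1 * y ^ k)"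
      by (simp add: x2_y_power x1y distrib_left lop.scale_left_diff_distrib of_nat_smul)
    have "xi (Suc (2 * k)) = c \<bullet> ((of_nat k - a) \<bullet> (x1 * y ^ k))"
      unfolding 1 c 2[symmetric] by (simp only: mult_smul smul_mult lop.scale_right_diff_distrib)
    then show ?thesis by (intro exI[of _ "c * (of_nat k - a)"]) (simp only: lop.scale_scale)
  qed
  have even: "\<exists>c. xi (2 * k) = c \<bullet> (y ^ k)"
  proof (induction k)
    case 0
    show ?case by (rule exI[of _ 1]) simp
  next
    case (Suc k)
    obtain c where c: "xi (Suc (2 * k)) = c \<bullet> (x1 * y ^ k)" using odd[OF Suc] by blast
    have 1: "xi (2 * Suc k) = x2 * xi (Suc (2 * k)) + xi (Suc (2 * k)) * (x2 + a \<bullet> x1)"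
      by (simp del: xi.simps add: xi.simps(2)[of "Suc (2 * k)"])
    have 2: "x2 * (x1 * y ^ k) + (x1 * y ^ k) * (x2 + a \<bullet> x1) = y ^ Suc k"
      by (simp add: x2_x1[THEN mult_assoc_rule] x2_y_power x1y x1_sq' mult_of_nat_left_commute
          distrib_left left_diff_distrib mult.assoc)
    have "xi (2 * Suc k) = c \<bullet> (y ^ Suc k)"
      unfolding 1 c 2[symmetric] by (simp only: mult_smul smul_mult lop.scale_right_distrib)
    then show ?case by blast
  qed
  show "\<exists>c. xi (2 * k) = c \<bullet> (y ^ k)" "\<exists>c. xi (Suc (2 * k)) = c \<bullet> (x1 * y ^ k)"
    using even odd by auto
qed

lemma y_xi: "y * xi n = xi n * y"
proof -
  have y: "y * y ^ k = y ^ k * y" for k by (rule power_commutes[symmetric])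
  consider k where "n = 2 * k" | k where "n = Suc (2 * k)" by (metis oddE evenE Suc_eq_plus1)
  then show ?thesis
  proof cases
    case 1
    then obtain c where "xi n = c \<bullet> (y ^ k)" using xi_eq(1)[of k] by blast
    then show ?thesis by (simp add: y)
  next
    case 2
    then obtain c where "xi n = c \<bullet> (x1 * y ^ k)" using xi_eq(2)[of k] by blast
    moreover have "y * (x1 * y ^ k) = x1 * y ^ k * y"
      by (simp only: mult.assoc y[symmetric]) (simp only: y_mv(5)[symmetric] mult.assoc[symmetric])
    ultimately show ?thesis by simp
  qed
qed

lemma y_zs:
  assumes "\<And>m. m \<le> n \<Longrightarrow> x1 * zs m = ((- 1) ^ m) \<bullet> (zs m * x1)"
  shows "y * zs n = zs n * y"
proof -
  have n: "x1 * zs n = ((- 1) ^ n) \<bullet> (zs n * x1)" "d2 * zs n = zs n * d2"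
    "g * zs n = ((- 1) ^ n) \<bullet> (zs n * g)"
    using assms d2_zs[of n] gh_zs[of n] by auto
  note r = n n[THEN mult_assoc_rule] d_zs d_zs[THEN mult_assoc_rule] ymv h_y h_y[THEN mult_assoc_rule] y_xi
    y_xi[THEN mult_assoc_rule]
  have "y * zs n - zs n * y = 0" (is "?R = 0")
  proof (rule zeroI)
    show "nul ?R" by (intro nul_intros nul_y nul_zs)
    show "d1 * ?R = ?R * d1" "d2 * ?R = ?R * d2" "d3 * ?R = ?R * d3"
      by (simp_all add: r algebra_simps eps_pow_sq)
  qed
  then show ?thesis by simp
qed

text \<open>Expanding \<open>y * zs m = zs m * y\<close> moves \<open>x1\<close> past
  \<open>x2\<close> in front of \<open>zs m\<close>. That identity comes from \<open>y_zs\<close>,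
  which uses the present statement up to \<open>m\<close>; hence the strong induction.\<close>

lemma x1_zs: "x1 * zs n = ((- 1) ^ n) \<bullet> (zs n * x1)"
proof (induction n rule: less_induct)
  case (less n)
  show ?case
  proof (cases n)
    case 0
    have "x1 * x3 - x3 * x1 = 0" (is "?R = 0")
    proof (rule zeroI)
      show "nul ?R" by (intro nul_intros nul_x)
      show "d1 * ?R = ?R * d1" "d2 * ?R = ?R * d2" "d3 * ?R = ?R * d3"
        by (simp_all add: mv algebra_simps)
    qed
    then show ?thesis using 0 by simp
  next
    case (Suc m)
    define s where "s = (- 1 :: 'k) ^ m"
    have s: "s * s = 1" by (simp add: s_def eps_pow_sq)
    have 1: "x1 * zs m = s \<bullet> (zs m * x1)" using less Suc by (simp add: s_def)
    have "y * zs m = zs m * y" using less Suc by (intro y_zs) simp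
    then have 2: "x1 * (x2 * zs m) = zs m * (x2 * x1) + zs m * (x1 * x2) - s \<bullet> (x2 * (zs m * x1))"
      by (simp add: y_def algebra_simps 1)
    have "x1 * zs (Suc m) = - (s \<bullet> (zs (Suc m) * x1))"
      by (simp add: s_def[symmetric] right_diff_distrib left_diff_distrib 2 1[THEN mult_assoc_rule]
          mult.assoc s lop.scale_right_diff_distrib)
    then show ?thesis using Suc by (simp add: s_def del: zs.simps)
  qed
qed

lemma xi_zs: "xi i * zs j = ((- 1) ^ (i * j)) \<bullet> (zs j * xi i)"
proof -
  have y: "y ^ k * zs j = zs j * y ^ k" for k
    by (rule power_commuting_commutes) (rule y_zs, rule x1_zs)
  consider k where "i = 2 * k" | k where "i = Suc (2 * k)" by (metis oddE evenE Suc_eq_plus1)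
  then show ?thesis
  proof cases
    case 1
    obtain c where c: "xi i = c \<bullet> (y ^ k)" using xi_eq(1)[of k] 1 by blast
    have "(- 1 :: 'k) ^ (i * j) = 1" unfolding 1 mult.assoc power_mult by simp
    then show ?thesis unfolding c by (simp add: y)
  next
    case 2
    obtain c where c: "xi i = c \<bullet> (x1 * y ^ k)" using xi_eq(2)[of k] 2 by blast
    have "i * j = 2 * (k * j) + j" by (simp add: 2)
    then have e: "(- 1 :: 'k) ^ (i * j) = (- 1) ^ j" by (simp add: power_add power_mult)
    have "x1 * y ^ k * zs j = ((- 1) ^ j) \<bullet> (zs j * (x1 * y ^ k))"
      by (simp only: mult.assoc y x1_zs[THEN mult_assoc_rule] smul_mult)
    then show ?thesis unfolding c e by (simp add: mult.commute)
  qed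
qed

lemma nilp_linear: assumes "q * q = 1" shows "nilp {x1, x2, x3}"
proof (rule nilp_all[OF x1_zs xi_zs assms _ _ nilp_block])
  show "2 * CHAR('k) \<noteq> 0" using char by auto
  obtain c where "xi (2 * CHAR('k)) = c \<bullet> (y ^ CHAR('k))" using xi_eq(1) by blast
  then have xi: "xi (2 * CHAR('k)) = 0" by (simp add: y_power)
  show "zs (2 * CHAR('k)) = 0"
  proof (rule zeroI)
    show "nul (zs (2 * CHAR('k)))" by (rule nul_zs)
    show "d1 * zs (2 * CHAR('k)) = zs (2 * CHAR('k)) * d1" by (rule d_zs)
    show "d2 * zs (2 * CHAR('k)) = zs (2 * CHAR('k)) * d2" by (rule d2_zs) (rule x1_zs)
    show "d3 * zs (2 * CHAR('k)) = zs (2 * CHAR('k)) * d3" by (simp add: d_zs xi)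
  qed
qed

end

locale super_strong = super_block x1 x2 x3 d1 d2 d3 g h "- 1" "- 1" 1
  for x1 x2 x3 d1 d2 d3 g h :: "(idx list, 'k::field) lop"
begin

text \<open>Here \<open>x1\<close> does not braided-commute with \<open>x3\<close>: besides \<open>z1 = ad x2 (x3)\<close> there are
  \<open>f0 = ad x1 (x3)\<close> and \<open>f1 = ad x1 (z1) = - ad x2 (f0)\<close>.\<close>

definition f0 where "f0 = x1 * x3 - x3 * x1"
definition z1 where "z1 = x2 * x3 - x3 * x2"
definition f1 where "f1 = - (x2 * f0 + f0 * x2)"

lemma x_x3: "x1 * x3 = x3 * x1 + f0" "x2 * x3 = x3 * x2 + z1"
  by (simp_all add: f0_def z1_def)

lemma x2_f0: "x2 * f0 = - (f0 * x2) - f1"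
  by (simp add: f1_def)

lemma x1_f0: "x1 * f0 = - (f0 * x1)"
  by (simp add: f0_def algebra_simps x1_sq x1_sq')

lemma nul_f: "nul f0" "nul z1" "nul f1"
proof -
  show f0: "nul f0" unfolding f0_def by (intro nul_intros nul_x)
  show "nul z1" unfolding z1_def by (intro nul_intros nul_x)
  have "nul (- (1 :: 'k) \<bullet> (x2 * f0 + f0 * x2))" using f0 by (intro nul_intros nul_x)
  then show "nul f1" by (simp add: f1_def)
qed

lemma f0_mv: "d1 * f0 = f0 * d1" "d2 * f0 = f0 * d2" "d3 * f0 = f0 * d3 + x1 * h + x1 * h"
  "g * f0 = - (f0 * g)" "h * f0 = f0 * h"
  by (simp_all add: f0_def mv algebra_simps)

lemma z1_mv: "d1 * z1 = z1 * d1" "d2 * z1 = z1 * d2" "d3 * z1 = z1 * d3 + x2 * h + x2 * h + x1 * h"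
  "g * z1 = f0 * g - z1 * g" "h * z1 = z1 * h + f0 * h"
  by (simp_all add: f0_def z1_def mv algebra_simps)

lemmas fmv = f0_mv z1_mv f0_mv[THEN mult_assoc_rule] z1_mv[THEN mult_assoc_rule] x1_f0
  x1_f0[THEN mult_assoc_rule] ymv

lemma f1_mv: "d1 * f1 = f1 * d1" "d2 * f1 = f1 * d2"
  "d3 * f1 = f1 * d3 - (x2 * x1 * h - x1 * x2 * h) - (x2 * x1 * h - x1 * x2 * h)" "g * f1 = f1 * g" "h * f1 = - (f1 * h)"
  by (simp_all add: f1_def fmv algebra_simps)

lemmas fmv' = fmv f1_mv f1_mv[THEN mult_assoc_rule]

lemma y_x3: "y * x3 = x3 * y + f0 * x1"
proof -
  have "y * x3 - x3 * y - f0 * x1 = 0" (is "?R = 0")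
  proof (rule zeroI)
    have "h * y = y * h" by (simp add: y_def mv algebra_simps x1_sq x1_sq')
    note r = fmv this this[THEN mult_assoc_rule]
    show "nul ?R" by (intro nul_intros nul_x nul_f nul_y)
    show "d1 * ?R = ?R * d1"
      by (simp add: r algebra_simps f0_def)
    show "d2 * ?R = ?R * d2" "d3 * ?R = ?R * d3"
      by (simp_all add: r algebra_simps)
  qed
  then show ?thesis by (simp add: algebra_simps)
qed

lemma x1_z1: "x1 * z1 = f0 * x1 + f1 - z1 * x1"
  using y_x3 by (simp add: y_def z1_def f1_def f0_def algebra_simps)

lemma x2_z1: "x2 * z1 = f0 * x2 - z1 * x2 + (1 / 2) \<bullet> f1"
proof -
  have "x2 * z1 + z1 * x2 - f0 * x2 - (1 / 2) \<bullet> f1 = 0" (is "?R = 0")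
  proof (rule zeroI)
    show "nul ?R" by (intro nul_intros nul_x nul_f)
    show "d1 * ?R = ?R * d1" "d2 * ?R = ?R * d2" "d3 * ?R = ?R * d3"
      by (simp_all add: fmv' algebra_simps lop.scale_right_diff_distrib lop.scale_right_distrib)
  qed
  then show ?thesis by (simp add: algebra_simps)
qed

lemma x1_f1: "x1 * f1 = f1 * x1"
proof -
  have "f1 = x1 * z1 + z1 * x1 - f0 * x1" by (simp add: x1_z1)
  then show ?thesis
    by (simp only:) (simp add: algebra_simps x1_sq x1_sq' x1_f0 x1_f0[THEN mult_assoc_rule])
qed

text \<open>\<open>f1\<close> is minus the anticommutator of \<open>x2\<close> and
  \<open>f0\<close>, so its commutator with \<open>x2\<close> reduces to that of
  \<open>t = x2 * x2\<close> with \<open>f0\<close>.\<close>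

lemma x2_f1: "x2 * f1 = f1 * x2"
proof -
  have ht: "h * t = t * h + y * h" by (simp add: t_def fmv y_def algebra_simps)
  have "t * f0 - f0 * t = 0" (is "?R = 0")
  proof (rule zeroI)
    show "nul ?R" unfolding t_def by (intro nul_intros nul_x nul_f)
    show "d1 * ?R = ?R * d1" "d2 * ?R = ?R * d2" "d3 * ?R = ?R * d3"
      by (simp_all add: fmv' tmv ht ht[THEN mult_assoc_rule] algebra_simps)
  qed
  then show ?thesis by (simp add: f1_def t_def algebra_simps)
qed

text \<open>Up to the factor - 2 and \<open>h\<close>, the \<open>d3\<close>-derivative of
  \<open>f1\<close>. It stays a symbol with its own exchange rules \<open>u_mv\<close>, so that
  rewriting need not straighten words in \<open>x1\<close> and \<open>x2\<close>.\<close>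

definition u where "u = x2 * x1 - x1 * x2"

lemma d3_f1: "d3 * f1 = f1 * d3 - u * h - u * h"
  unfolding f1_mv u_def by (simp add: algebra_simps)

lemmas xr = x_x3 x1_f0 x2_f0 x1_z1 x2_z1 x1_f1 x2_f1
lemmas xr' = xr xr[THEN mult_assoc_rule]

lemma u_mv: "u * x3 = x3 * u + (z1 * x1 - f0 * x2 - f1) + (z1 * x1 - f0 * x2 - f1) - f0 * x1"
  "u * f0 = f0 * u + f1 * x1 + f1 * x1"
  "u * z1 = z1 * u - f0 * u - f0 * u - f1 * x1 - f1 * x1 + f1 * x2 + f1 * x2"
  "u * f1 = f1 * u"
  by (simp_all add: u_def xr' algebra_simps lop.scale_right_distrib)

lemmas rel_mv = xr' u_mv u_mv[THEN mult_assoc_rule] fmv f1_mv(1,2,4,5) f1_mv(1,2,4,5)[THEN mult_assoc_rule]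
  d3_f1 d3_f1[THEN mult_assoc_rule]

text \<open>The right factors are fixed to be the derivations, so the simplifier meets no
  unknowns.\<close>

lemma K_zeroI:
  assumes "nul R" "d1 * R = R * d1" "d2 * R = R * d2" "d3 * R = R * d3" shows "R = 0"
  using assms by (rule zeroI)

lemma squares: "x3 * x3 = 0" "f0 * f0 = 0" "z1 * z1 = 0" "f1 * f1 = 0"
  by (rule K_zeroI; (intro nul_intros nul_x nul_f | simp add: rel_mv algebra_simps lop.scale_right_distrib; fail))+

lemma rel_x3: "x3 * f0 = - (f0 * x3)" "x3 * z1 = - (z1 * x3)"
proof -
  have "x3 * f0 + f0 * x3 = 0" "x3 * z1 + z1 * x3 = 0"
    by (rule K_zeroI; (intro nul_intros nul_x nul_f | simp add: rel_mv algebra_simps; fail))+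
  then show "x3 * f0 = - (f0 * x3)" "x3 * z1 = - (z1 * x3)"
    by (simp_all add: eq_neg_iff_add_eq_0)
qed

lemma z1_f0: "z1 * f0 = - (f0 * z1)"
proof -
  have "z1 * f0 + f0 * z1 = 0"
    by (rule K_zeroI; (intro nul_intros nul_x nul_f | simp add: rel_mv algebra_simps; fail))
  then show ?thesis by (simp add: eq_neg_iff_add_eq_0)
qed

lemma f1_f0: "f0 * f1 = f1 * f0"
proof -
  have "f0 * f1 - f1 * f0 = 0"
    by (rule K_zeroI; (intro nul_intros nul_x nul_f | simp add: rel_mv algebra_simps; fail))
  then show ?thesis by simp
qed

lemma z1_f1: "z1 * f1 = f1 * z1 + f0 * f1"
proof -
  have "z1 * f1 - f1 * z1 - f0 * f1 = 0"
    by (rule K_zeroI; (intro nul_intros nul_x nul_f | simp add: rel_mv algebra_simps; fail))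
  then show ?thesis by (simp add: algebra_simps)
qed

lemma x3_f1: "x3 * f1 = - (f1 * x3) - f0 * z1 - f0 * z1"
proof -
  have "x3 * f1 + f1 * x3 + f0 * z1 + f0 * z1 = 0"
    by (rule K_zeroI; (intro nul_intros nul_x nul_f | simp add: rel_mv algebra_simps; fail))
  then show ?thesis by (simp add: algebra_simps eq_neg_iff_add_eq_0)
qed

lemma nilp_sq: "z * z = 0 \<Longrightarrow> nilp {z :: (idx list, 'k) lop}"
  using nilp_singleton[of z 2] by (simp add: power2_eq_square)

lemma nilp_all: "nilp {x1, x2, x3}"
proof -
  \<comment> \<open>Among \<open>x3\<close>, \<open>f0\<close>, \<open>z1\<close>, \<open>f1\<close>
    every exchange keeps two factors, so weight 1 is enough. The degrees 1, 2, 2, 3 enter only with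
    \<open>x1\<close> and \<open>x2\<close>, where for instance \<open>x1 * x3\<close> produces the
    single factor \<open>f0\<close>.\<close>
  have "nilp ({f0} \<union> fst ` {(f1, 1::nat)})"
  proof (rule nilp_pbw[where P = 1])
    show "nilp {f0}" "nilp (fst ` {(f1, 1::nat)})" using nilp_sq squares by auto
    fix x z and w :: nat assume "x \<in> {f0}" "(z, w) \<in> {(f1, 1::nat)}"
    then have *: "x = f0" "z = f1" "w = 1" by auto
    show "x * z \<in> lop.span (pbw_terms {f0} {(f1, 1)} (Suc w))"
      unfolding * f1_f0 by (intro lop.span_base pbw_zx[of _ 1]) auto
  qed auto
  then have "nilp (fst ` {(f0, 1::nat), (f1, 1)})" by (simp add: insert_commute)
  then have "nilp ({z1} \<union> fst ` {(f0, 1::nat), (f1, 1)})"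
  proof (rule nilp_pbw[where P = 1, rotated])
    show "nilp {z1}" using nilp_sq squares by auto
    fix x z and w :: nat assume "x \<in> {z1}" "(z, w) \<in> {(f0, 1), (f1, 1)}"
    then consider "x = z1" "z = f0" "w = 1" | "x = z1" "z = f1" "w = 1" by auto
    then show "x * z \<in> lop.span (pbw_terms {z1} {(f0, 1), (f1, 1)} (Suc w))"
    proof cases
      case 1
      show ?thesis unfolding 1 z1_f0 by (intro pbw_span lop.span_base pbw_zx[of _ 1]) auto
    next
      case 2
      show ?thesis unfolding 2 z1_f1
        by (intro pbw_span lop.span_base pbw_zx[of _ 1] pbw_zz[of _ 1 _ _ 1]) auto
    qed
  qed auto
  then have "nilp (fst ` {(f0, 1::nat), (z1, 1), (f1, 1)})" by (simp add: insert_commute)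
  then have "nilp ({x3} \<union> fst ` {(f0, 1::nat), (z1, 1), (f1, 1)})"
  proof (rule nilp_pbw[where P = 1, rotated])
    show "nilp {x3}" using nilp_sq squares by auto
    fix x z and w :: nat assume "x \<in> {x3}" "(z, w) \<in> {(f0, 1), (z1, 1), (f1, 1)}"
    then consider "x = x3" "z = f0" "w = 1" | "x = x3" "z = z1" "w = 1" | "x = x3" "z = f1" "w = 1" by auto
    then show "x * z \<in> lop.span (pbw_terms {x3} {(f0, 1), (z1, 1), (f1, 1)} (Suc w))"
    proof cases
      case 1
      show ?thesis unfolding 1 rel_x3 by (intro pbw_span lop.span_base pbw_zx[of _ 1]) auto
    next
      case 2
      show ?thesis unfolding 2 rel_x3 by (intro pbw_span lop.span_base pbw_zx[of _ 1]) auto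
    next
      case 3
      show ?thesis unfolding 3 x3_f1
        by (intro pbw_span lop.span_base pbw_zx[of _ 1] pbw_zz[of _ 1 _ _ 1]) auto
    qed
  qed auto
  then have nZ: "nilp (fst ` {(x3, 1::nat), (f0, 2), (z1, 2), (f1, 3)})" by (simp add: insert_commute)
  let ?Z = "{(x3, 1::nat), (f0, 2), (z1, 2), (f1, 3)}"
  have "nilp ({x1, x2} \<union> fst ` ?Z)"
  proof (rule nilp_pbw[where P = 3, OF nilp_block nZ])
    fix x z and w :: nat assume "x \<in> {x1, x2}" "(z, w) \<in> ?Z"
    then have w: "x = x1 \<or> x = x2" "(z = x3 \<and> w = 1) \<or> (z = f0 \<and> w = 2) \<or> (z = z1 \<and> w = 2) \<or> (z = f1 \<and> w = 3)"
      by auto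
    have in1: "r * x' \<in> pbw_terms {x1, x2} ?Z n" if "(r, m) \<in> ?Z" "x' \<in> {x1, x2}" "n \<le> Suc m" for r x' m n
      using that by (rule pbw_zx)
    have in0: "r \<in> pbw_terms {x1, x2} ?Z n" if "(r, m) \<in> ?Z" "n \<le> m" for r m n
      using that by (rule pbw_z)
    have Z: "(x3, 1) \<in> ?Z" "(f0, 2) \<in> ?Z" "(z1, 2) \<in> ?Z" "(f1, 3) \<in> ?Z" by simp_all
    have X: "x1 \<in> {x1, x2}" "x2 \<in> {x1, x2}" by simp_all
    note i = Z(1)[THEN in1] Z(2)[THEN in1] Z(3)[THEN in1] Z(4)[THEN in1] Z(2)[THEN in0] Z(3)[THEN in0] Z(4)[THEN in0]
    have "x1 * x3 \<in> lop.span (pbw_terms {x1, x2} ?Z 2)" "x2 * x3 \<in> lop.span (pbw_terms {x1, x2} ?Z 2)"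
      "x1 * f0 \<in> lop.span (pbw_terms {x1, x2} ?Z 3)" "x2 * f0 \<in> lop.span (pbw_terms {x1, x2} ?Z 3)"
      "x1 * z1 \<in> lop.span (pbw_terms {x1, x2} ?Z 3)" "x2 * z1 \<in> lop.span (pbw_terms {x1, x2} ?Z 3)"
      "x1 * f1 \<in> lop.span (pbw_terms {x1, x2} ?Z 4)" "x2 * f1 \<in> lop.span (pbw_terms {x1, x2} ?Z 4)"
      unfolding xr by (intro pbw_span lop.span_base i X; simp)+
    then show "x * z \<in> lop.span (pbw_terms {x1, x2} ?Z (Suc w))"
      using w by (auto simp: numeral_2_eq_2 numeral_3_eq_3 eval_nat_numeral)
  qed auto
  then show ?thesis by (rule nilp_subset) auto
qed

end

section \<open>The braiding of one block and one point\<close>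

lemma group_braiding_braid_V: "group_braiding (braid_V eps q12 q21 q22 a)"
proof
  fix i j l m
  let ?A = "braid_V eps q12 q21 q22 a"
  show "(\<Sum>k\<in>UNIV. ?A j l k * ?A i k m) = (\<Sum>k\<in>UNIV. ?A i l k * ?A j k m)"
    by (cases i; cases j; cases l; cases m) (simp_all add: UNIV_idx algebra_simps)
  have "?A X1 = ?A X2"
  proof (intro ext)
    fix j k show "?A X1 j k = ?A X2 j k" by (cases j) simp_all
  qed
  then show "?A i j m \<noteq> 0 \<Longrightarrow> ?A m = ?A j"
    by (cases i; cases j; cases m) simp_all
qed

text \<open>Composing with diagonal operators replaces \<open>(q\<^sub>1\<^sub>2, q\<^sub>2\<^sub>1)\<close> by \<open>(1, q\<^sub>1\<^sub>2 q\<^sub>2\<^sub>1)\<close>.\<close>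

lemma nichols_fin_dim_braid_V:
  fixes eps q12 q21 q22 a :: "'k::field"
  assumes char: "prime CHAR('k)" "CHAR('k) > 2" and q12: "q12 \<noteq> 0"
    and nilp: "\<And>x1 x2 x3 d1 d2 d3 g h :: (idx list, 'k) lop.
      block_point x1 x2 x3 d1 d2 d3 g h eps (q12 * q21) q22 a \<Longrightarrow> nilp {x1, x2, x3}"
  shows "nichols_fin_dim (braid_V eps q12 q21 q22 a)"
proof -
  define A where "A = braid_V eps q12 q21 q22 a"
  interpret group_braiding A unfolding A_def by (rule group_braiding_braid_V)
  \<comment> \<open>\<open>K\<close> multiplies by \<open>q12\<close> for each block letter,
    \<open>L\<close> divides by \<open>q12\<close> for each letter \<open>X3\<close>. Attaching
    \<open>K\<close> to the third letter and \<open>L\<close> to \<open>d1\<close>,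
    \<open>d2\<close>, \<open>g\<close> cancels \<open>q12\<close> there, while
    \<open>h = Gop A X3 * K\<close> turns \<open>q21\<close> into \<open>q12 * q21\<close>.\<close>
  define \<chi> :: "idx \<Rightarrow> 'k" where "\<chi> i = (if i = X3 then 1 else q12)" for i
  define \<rho> :: "idx \<Rightarrow> 'k" where "\<rho> i = (if i = X3 then q12 else 1)" for i
  define K where "K = Kop \<chi>"
  define Ki where "Ki = Kop (\<lambda>i. 1 / \<chi> i)"
  define L where "L = Kop (\<lambda>i. 1 / \<rho> i)"
  define Li where "Li = Kop \<rho>"
  have [simp]: "\<chi> X1 = q12" "\<chi> X2 = q12" "\<chi> X3 = 1" "\<rho> X1 = 1" "\<rho> X2 = 1" "\<rho> X3 = q12"
    by (simp_all add: \<chi>_def \<rho>_def)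
  have nz: "\<chi> i \<noteq> 0" "\<rho> i \<noteq> 0" for i using q12 by (simp_all add: \<chi>_def \<rho>_def)
  have inv: "K * Ki = 1" "Li * L = 1"
    by (simp_all add: K_def Ki_def L_def Li_def K_K nz K_1)
  have compat: "A i k j \<noteq> 0 \<Longrightarrow> \<chi> k = \<chi> j" "A i k j \<noteq> 0 \<Longrightarrow> \<rho> k = \<rho> j" for i j k
    unfolding A_def by (cases i; cases j; cases k; simp)+
  have compat': "A i k j \<noteq> 0 \<Longrightarrow> 1 / \<rho> k = 1 / \<rho> j" for i j k
    by (drule compat(2)) simp
  have KX: "K * Xop A i = \<chi> i \<bullet> (Xop A i * K)" for i
    unfolding K_def by (rule K_X) (rule compat(1))
  have LX: "L * Xop A i = (1 / \<rho> i) \<bullet> (Xop A i * L)" for i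
    unfolding L_def by (rule K_X) (rule compat')
  have GK: "Gop A i * K = K * Gop A i" for i
    unfolding K_def by (rule K_G[symmetric]) (rule compat(1))
  have GL: "Gop A i * L = L * Gop A i" for i
    unfolding L_def by (rule K_G[symmetric]) (rule compat')
  have DK: "Dop i * K = \<chi> i \<bullet> (K * Dop i)" for i unfolding K_def by (rule D_K)
  have DL: "Dop i * L = (1 / \<rho> i) \<bullet> (L * Dop i)" for i unfolding L_def by (rule D_K)
  have DLi: "Dop i * Li = \<rho> i \<bullet> (Li * Dop i)" for i unfolding Li_def by (rule D_K)
  have LK: "L * K = K * L" unfolding L_def K_def K_K by (simp add: mult.commute)
  have G12: "Gop A X2 = Gop A X1"
  proof (rule lop_eqI)
    have *: "A X2 = A X1" unfolding A_def
    proof (intro ext)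
      fix j k show "braid_V eps q12 q21 q22 a X2 j k = braid_V eps q12 q21 q22 a X1 j k" by (cases j) simp_all
    qed
    then show "app (Gop A X2) f w = app (Gop A X1) f w" for f w
      by (simp add: Gop.rep_eq gact_same[OF *])
  qed
  have act: "A X1 X1 k = (if k = X1 then eps else 0)"
    "A X1 X2 k = (if k = X2 then eps else if k = X1 then 1 else 0)"
    "A X1 X3 k = (if k = X3 then q12 else 0)"
    "A X3 X1 k = (if k = X1 then q21 else 0)"
    "A X3 X2 k = (if k = X2 then q21 else if k = X1 then q21 * a else 0)"
    "A X3 X3 k = (if k = X3 then q22 else 0)" for k
    by (simp_all add: A_def)
  have GX: "Gop A X1 * Xop A X1 = eps \<bullet> (Xop A X1 * Gop A X1)"
    "Gop A X1 * Xop A X2 = eps \<bullet> (Xop A X2 * Gop A X1) + Xop A X1 * Gop A X1"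
    "Gop A X1 * Xop A X3 = q12 \<bullet> (Xop A X3 * Gop A X1)"
    "Gop A X3 * Xop A X1 = q21 \<bullet> (Xop A X1 * Gop A X3)"
    "Gop A X3 * Xop A X2 = q21 \<bullet> (Xop A X2 * Gop A X3) + (q21 * a) \<bullet> (Xop A X1 * Gop A X3)"
    "Gop A X3 * Xop A X3 = q22 \<bullet> (Xop A X3 * Gop A X3)"
    by (simp_all add: G_X UNIV_idx act add.commute)
  note r = KX LX GK GL DK DL LK GX D_X
  note r' = G12 r r[THEN mult_assoc_rule]
  have bp: "block_point (Xop A X1) (Xop A X2) (Xop A X3 * K) (L * Dop X1) (L * Dop X2) (Dop X3)
      (L * Gop A X1) (Gop A X3 * K) eps (q12 * q21) q22 a"
  proof
    show "L * Dop X1 * Xop A X1 = Xop A X1 * (L * Dop X1) + L * Gop A X1"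
      "L * Dop X1 * Xop A X2 = Xop A X2 * (L * Dop X1)"
      "L * Dop X1 * (Xop A X3 * K) = Xop A X3 * K * (L * Dop X1)"
      "L * Dop X2 * Xop A X1 = Xop A X1 * (L * Dop X2)"
      "L * Dop X2 * Xop A X2 = Xop A X2 * (L * Dop X2) + L * Gop A X1"
      "L * Dop X2 * (Xop A X3 * K) = Xop A X3 * K * (L * Dop X2)"
      "Dop X3 * Xop A X1 = Xop A X1 * Dop X3"
      "Dop X3 * Xop A X2 = Xop A X2 * Dop X3"
      "Dop X3 * (Xop A X3 * K) = Xop A X3 * K * Dop X3 + Gop A X3 * K"
      "L * Gop A X1 * Xop A X1 = eps \<bullet> (Xop A X1 * (L * Gop A X1))"
      "L * Gop A X1 * Xop A X2 = eps \<bullet> (Xop A X2 * (L * Gop A X1)) + Xop A X1 * (L * Gop A X1)"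
      "L * Gop A X1 * (Xop A X3 * K) = Xop A X3 * K * (L * Gop A X1)"
      "Gop A X3 * K * Xop A X1 = (q12 * q21) \<bullet> (Xop A X1 * (Gop A X3 * K))"
      "Gop A X3 * K * Xop A X2 = (q12 * q21) \<bullet> (Xop A X2 * (Gop A X3 * K))
        + (q12 * q21 * a) \<bullet> (Xop A X1 * (Gop A X3 * K))"
      "Gop A X3 * K * (Xop A X3 * K) = q22 \<bullet> (Xop A X3 * K * (Gop A X3 * K))"
      using q12
      by (simp_all add: r' mult.assoc mult.commute mult.left_commute distrib_left distrib_right
          lop.scale_right_distrib)
    show "nul (Xop A X1)" "nul (Xop A X2)" "nul (Xop A X3 * K)"
      by (intro nul_mult nul_X)+
    show "prime CHAR('k)" "CHAR('k) > 2" by (fact char)+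
    fix R T1 T2 T3
    assume R: "nul R" "L * Dop X1 * R = R * T1" "L * Dop X2 * R = R * T2" "Dop X3 * R = R * T3"
    show "R = 0"
    proof (rule lop_zeroI)
      \<comment> \<open>\<open>d1\<close> and \<open>d2\<close> carry the left factor
        \<open>L\<close>; inverting it puts \<open>Li\<close> in front of \<open>R\<close>, so the
        class must contain all \<open>Li ^ m * R\<close>.\<close>
      show "R \<in> range (\<lambda>m. Li ^ m * R)" by (rule range_eqI[of _ _ 0]) simp
      fix S assume "S \<in> range (\<lambda>m. Li ^ m * R)"
      then obtain m where S: "S = Li ^ m * R" by blast
      show "nul S" unfolding S
        by (induction m) (simp_all add: R(1) Li_def mult.assoc nul_K)
      fix i
      have D12: "Dop i * R = Li * R * T" if "L * Dop i * R = R * T" for i T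
      proof -
        have "Dop i * R = (Li * L) * (Dop i * R)" by (simp only: inv mult_1)
        also have "\<dots> = Li * (L * Dop i * R)" by (simp only: mult.assoc)
        also have "\<dots> = Li * (R * T)" by (simp only: that)
        finally show ?thesis by (simp only: mult.assoc)
      qed
      have Dm: "Dop i * Li ^ m = (\<rho> i ^ m) \<bullet> (Li ^ m * Dop i)" for i m
        by (induction m) (simp_all add: DLi DLi[THEN mult_assoc_rule] mult.assoc)
      obtain n T where nT: "Dop i * R = Li ^ n * R * T"
      proof (cases i)
        case X1 then show ?thesis using D12[OF R(2)] that[of 1] by simp
      next
        case X2 then show ?thesis using D12[OF R(3)] that[of 1] by simp
      next
        case X3 then show ?thesis using R(4) that[of 0] by simp
      qed
      have "Dop i * S = (Li ^ (m + n) * R) * ((\<rho> i ^ m) \<bullet> T)"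
        unfolding S by (simp add: Dm[THEN mult_assoc_rule] nT mult.assoc power_add)
      then show "\<exists>R'\<in>range (\<lambda>m. Li ^ m * R). \<exists>T. Dop i * S = R' * T" by blast
    qed
  qed
  \<comment> \<open>A word in the rescaled letters is a nonzero multiple of the original word times
    a power of the invertible \<open>K\<close>, so its vanishing carries over.\<close>
  define Y where "Y i = (if i = X3 then Xop A X3 * K else Xop A i)" for i
  have Y: "Y X3 = Xop A X3 * K" "i \<noteq> X3 \<Longrightarrow> Y i = Xop A i" for i by (simp_all add: Y_def)
  obtain N where N: "\<And>xs. set xs \<subseteq> {Xop A X1, Xop A X2, Xop A X3 * K} \<Longrightarrow> N \<le> length xs \<Longrightarrow> prod_list xs = 0"
    using nilp[OF bp] unfolding nilp_def by blast
  have Kw: "\<exists>c. c \<noteq> 0 \<and> K * prod_list (map (Xop A) w) = c \<bullet> (prod_list (map (Xop A) w) * K)" for w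
  proof (induction w)
    case Nil
    show ?case by (rule exI[of _ 1]) simp
  next
    case (Cons i w)
    then obtain c where "c \<noteq> 0" "K * prod_list (map (Xop A) w) = c \<bullet> (prod_list (map (Xop A) w) * K)" by blast
    then show ?case
      using nz(1)[of i] by (intro exI[of _ "\<chi> i * c"]) (simp add: KX[THEN mult_assoc_rule] mult.assoc)
  qed
  have word: "\<exists>c m. c \<noteq> 0 \<and> prod_list (map Y w) = c \<bullet> (prod_list (map (Xop A) w) * K ^ m)" for w
  proof (induction w)
    case Nil
    show ?case by (rule exI[of _ 1], rule exI[of _ 0]) simp
  next
    case (Cons i w)
    then obtain c m where c: "c \<noteq> 0" "prod_list (map Y w) = c \<bullet> (prod_list (map (Xop A) w) * K ^ m)" by blast
    show ?case
    proof (cases "i = X3")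
      case True
      obtain e where e: "e \<noteq> 0" "K * prod_list (map (Xop A) w) = e \<bullet> (prod_list (map (Xop A) w) * K)"
        using Kw by blast
      show ?thesis using c e True
        by (intro exI[of _ "c * e"] exI[of _ "Suc m"]) (simp add: Y e(2)[THEN mult_assoc_rule] mult.assoc)
    next
      case False
      then show ?thesis using c by (intro exI[of _ c] exI[of _ m]) (simp add: Y mult.assoc)
    qed
  qed
  have KKi: "K ^ m * Ki ^ m = 1" for m
  proof (induction m)
    case (Suc m)
    have "K ^ Suc m * Ki ^ Suc m = K * (K ^ m * Ki ^ m) * Ki"
      unfolding power_Suc[of K] power_Suc2[of Ki] by (simp only: mult.assoc)
    then show ?case by (simp only: Suc mult_1_right inv)
  qed simp
  have "phi A w v = 0" if "N \<le> length w" for w v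
  proof -
    have "set (map Y w) \<subseteq> {Xop A X1, Xop A X2, Xop A X3 * K}"
    proof
      fix z assume "z \<in> set (map Y w)"
      then obtain i where "z = Y i" by auto
      then show "z \<in> {Xop A X1, Xop A X2, Xop A X3 * K}" by (cases i) (simp_all add: Y_def)
    qed
    then have "prod_list (map Y w) = 0" using that by (intro N) simp_all
    then obtain m where m: "prod_list (map (Xop A) w) * K ^ m = 0" using word[of w] by auto
    have "prod_list (map (Xop A) w) = prod_list (map (Xop A) w) * K ^ m * Ki ^ m"
      by (simp only: mult.assoc KKi mult_1_right)
    then have "prod_list (map (Xop A) w) = 0" by (simp only: m mult_zero_left)
    then show ?thesis by (simp add: phi_Xop app_ring)
  qed
  then show ?thesis unfolding A_def by (rule nichols_fin_dimI[unfolded A_def])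
qed

theorem theorem4p1:
  fixes eps q12 q21 q22 a :: "'k::field"
  assumes "alg_closed TYPE('k)"
    and "prime CHAR('k)" and "CHAR('k) > 2"
    and "eps = 1 \<or> eps = -1"
    and "q12 \<noteq> 0" and "q21 \<noteq> 0" and "q22 \<noteq> 0"
    and "(eps = 1 \<and> q12 * q21 = 1 \<and> q22 = 1 \<and> in_Fp_units a)
       \<or> (eps = 1 \<and> q12 * q21 = 1 \<and> q22 = -1 \<and> in_Fp_units a)
       \<or> (eps = 1 \<and> q12 * q21 = 1 \<and> q22 ^ 3 = 1 \<and> q22 \<noteq> 1 \<and> 2 * a = -1)
       \<or> (eps = -1 \<and> q12 * q21 = 1 \<and> q22 = 1 \<and> in_Fp_units a)
       \<or> (eps = -1 \<and> q12 * q21 = 1 \<and> q22 = -1 \<and> in_Fp_units a)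
       \<or> (eps = -1 \<and> q12 * q21 = -1 \<and> q22 = -1 \<and> a = 1)"
  shows "nichols_fin_dim (braid_V eps q12 q21 q22 a)"
proof (rule nichols_fin_dim_braid_V)
  fix x1 x2 x3 d1 d2 d3 g h :: "(idx list, 'k) lop"
  assume bp: "block_point x1 x2 x3 d1 d2 d3 g h eps (q12 * q21) q22 a"
  have jordan: "jordan_point x1 x2 x3 d1 d2 d3 g h q22 a" if "eps = 1" "q12 * q21 = 1"
    using bp unfolding that by (intro jordan_point.intro weak_point.intro weak_point_axioms.intro) simp_all
  have super: "super_weak x1 x2 x3 d1 d2 d3 g h q22 a" if "eps = - 1" "q12 * q21 = 1"
    using bp unfolding that
    by (intro super_weak.intro super_block.intro weak_point.intro weak_point_axioms.intro) simp_all
  \<comment> \<open>The values 1 and - 1 of \<open>q22\<close> are merged into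
    \<open>q22 * q22 = 1\<close>, the form in which the skew commutation of the \<open>zs\<close>
    uses them.\<close>
  consider "eps = 1" "q12 * q21 = 1" "q22 * q22 = 1"
    | "eps = 1" "q12 * q21 = 1" "q22 ^ 3 = 1" "q22 \<noteq> 1" "2 * a = - 1"
    | "eps = - 1" "q12 * q21 = 1" "q22 * q22 = 1"
    | "eps = - 1" "q12 * q21 = - 1" "q22 = - 1" "a = 1"
    using assms(8) by fastforce
  then show "nilp {x1, x2, x3}"
  proof cases
    case 1
    then show ?thesis using jordan_point.nilp_linear[OF jordan] by blast
  next
    case 2
    have "(q22 - 1) * (1 + q22 + q22 * q22) = 0"
      using 2(3) by (simp add: algebra_simps power3_eq_cube)
    then have "1 + q22 + q22 * q22 = 0" using 2(4) by simp
    then show ?thesis using jordan_point.nilp_A2[OF jordan] 2 by blast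
  next
    case 3
    then show ?thesis using super_weak.nilp_linear[OF super] by blast
  next
    case 4
    have "super_strong x1 x2 x3 d1 d2 d3 g h"
      using bp unfolding 4 by (intro super_strong.intro super_block.intro)
    then show ?thesis by (rule super_strong.nilp_all)
  qed
qed (use assms in auto)

end
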